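(* Let $\mathcal{G}$ be a connected (undirected, weighted) graph on $N$ nodes with weights $\mathsf{a}_{ij}=\mathsf{a}_{ji}$ and Laplacian $\mathsf{L}$ with eigenvalues $0=\lambda_1<\lambda_2\le\dots\le\lambda_N$. For each $i\in\{1,\dots,N\}$ let $f^i:\mathbb{R}^d\to\mathbb{R}$ be differentiable and $m^i$-strongly convex ($m^i>0$), with $\nabla f^i$ being $M^i$-Lipschitz on $\mathbb{R}^d$ ($M^i>0$). Put $\underline{m}=\min_i m^i$ and $\overline{M}=\max_i M^i$. Let $\mathsf{x}^\star$ be the minimizer of $f=\sum_{i=1}^N f^i$. Let $\alpha,\beta>0$, $0<\epsilon<1$, and let $\delta>0$ be such that $$\phi=\frac{1}{2\underline{m}}\overline{M}^2+\frac{1}{2\underline{m}\alpha^2}\delta-1>0 .$$ Define $\zeta>0$ and $\tau$ by $$\zeta^2=\frac{2\epsilon(1-\epsilon)\lambda_2\min\{\delta,1\}}{\alpha\beta\lambda_N^2\phi+4\alpha^2\lambda_2(1+\phi)^2},\qquad \tau=\frac{1}{\alpha\overline{M}+1}\ln\Big(1+\frac{(\alpha\overline{M}+1)\zeta}{\alpha\overline{M}+1+\beta\lambda_N\sqrt{1+\alpha^2}\,(1+\zeta)}\Big),$$ and let $$\kappa=2\,\frac{\epsilon\delta\lambda_2+2\phi\alpha\beta\lambda_2^2\epsilon^2(1-\epsilon)}{\alpha\beta\phi\lambda_N^2+2\lambda_2\alpha^2(1+\phi)^2}$$ (which satisfies $\kappa<1$). Consider the system $$\dot v^i=\alpha\beta\sum_{j=1}^N\mathsf{a}_{ij}(\hat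 x^i-\hat x^j),\qquad \dot x^i=-\alpha\nabla f^i(x^i)-\beta\sum_{j=1}^N\mathsf{a}_{ij}(\hat x^i-\hat x^j)-v^i,\qquad i\in\{1,\dots,N\},$$ where $\hat x^i(t)=x^i(t_k)$ for $t\in[t_k,t_{k+1})$ and the synchronous communication times are determined by $t_0=0$ and the rule that $t_{k+1}$ is the largest $t\in[t_k+\tau,\infty)$ such that $$\|\Pi(x(t_k)-x(s))\|^2\le\kappa\|\Pi x(s)\|^2\quad\text{for all } s\in[t_k+\tau,t],$$ with $t_{k+1}=t_k+\tau$ if the inequality fails at $s=t_k+\tau$, and no further communication ($t_{k+1}=\infty$) if it holds for all $s\ge t_k+\tau$. Here $x=(x^1,\dots,x^N)$ and $\Pi=(I_N-\frac1N\mathbf{1}_N\mathbf{1}_N^\top)\otimes I_d$. Then, for every initial condition $x^i(0),v^i(0)\in\mathbb{R}^d$, $i\in\{1,\dots,N\}$, with $\sum_{i=1}^N v^i(0)=0$, and each $i\in\{1,\dots,N\}$, one has $x^i(t)\to\mathsf{x}^\star$ exponentially fast as $t\to\infty$ with a rate no less than $$\frac{\tfrac14\min\{\delta,\,2\phi\alpha\beta\lambda_2(1-\epsilon)^2,\,1-\epsilon,\,\tfrac12\epsilon\}}{\bar\lambda_E}>0,$$ where $\bar\lambda_E$ is the maximum eigenvalue of the matrix $E$ defined in the context, formed with the system parameters $\alpha,\beta>0$ and with $\phi=\frac{1}{2\underline{m}}\overline{M}^2+\frac{1}{2\underline{m}\alpha^2}\delta-1$.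
   Context: A weighted graph on nodes $\{1,\dots,N\}$ ($N\ge 2$) has a nonnegative adjacency matrix $\mathsf{A}=(\mathsf{a}_{ij})$ with $\mathsf{a}_{ij}>0$ iff $(i,j)$ is an edge and $\mathsf{a}_{ij}=0$ otherwise. Connected graph means undirected ($\mathsf{a}_{ij}=\mathsf{a}_{ji}$) with a path between every pair of nodes. The Laplacian is $\mathsf{L}=\mathrm{Diag}(\mathsf{d}^1_{\rm out},\dots,\mathsf{d}^N_{\rm out})-\mathsf{A}$ with $\mathsf{d}^i_{\rm out}=\sum_j\mathsf{a}_{ij}$. Let $\mathsf{R}\in\mathbb{R}^{N\times(N-1)}$ satisfy $\mathbf{1}_N^\top\mathsf{R}=0$, $\mathsf{R}^\top\mathsf{R}=I_{N-1}$ and $\mathsf{R}\mathsf{R}^\top=I_N-\frac1N\mathbf{1}_N\mathbf{1}_N^\top$, and $$E=\frac12\begin{bmatrix}\alpha(\phi+1)I_d&0&0\\0&\alpha(\phi+1)I_{(N-1)d}&I_{(N-1)d}\\0&I_{(N-1)d}&\tfrac1\alpha I_{(N-1)d}+\tfrac{\phi+1}{\beta}(\mathsf{R}^\top\mathsf{L}\mathsf{R})^{-1}\otimes I_d\end{bmatrix}$$ (the eigenvalues of $E$ do not depend on the choice of $\mathsf{R}$). In the triggering rule, $x(s)$ for $s\ge t_k$ denotes the trajectory obtained while $\hat x$ is held at $x(t_k)$. A differentiable $f$ is $m$-strongly convex if $(z-x)^\top(\nabla f(z)-\nabla f(x))\ge m\|z-x\|^2$ for all $x,z$. A map $g$ is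 $M$-Lipschitz if $\|g(x)-g(y)\|\le M\|x-y\|$ for all $x,y$. Norms are Euclidean. Convergence $x^i(t)\to\mathsf{x}^\star$ exponentially fast with rate no less than $r>0$ means that there is a constant $C\ge0$ (depending on the initial condition) with $\|x^i(t)-\mathsf{x}^\star\|\le Ce^{-rt}$ for all $t\ge0$. *)

theory Defs
  imports "HOL-Analysis.Analysis"
begin

section \<open>Matrices\<close>

definition eigenvalue :: "real^'n^'n \<Rightarrow> real \<Rightarrow> bool" where
  "eigenvalue A c \<longleftrightarrow> (\<exists>v. v \<noteq> 0 \<and> A *v v = c *\<^sub>R v)"

text \<open>The numbers \<open>lam 1 \<le> \<dots> \<le> lam n\<close> are the eigenvalues of an \<open>n \<times> n\<close> matrix, repeated
  according to their multiplicity as roots of the characteristic polynomial.\<close>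

definition ordered_eigenvalues :: "real^'n^'n \<Rightarrow> (nat \<Rightarrow> real) \<Rightarrow> bool" where
  "ordered_eigenvalues A lam \<longleftrightarrow>
     mono_on {1..CARD('n)} lam \<and> (\<forall>z. det (mat z - A) = (\<Prod>k=1..CARD('n). z - lam k))"

definition kronecker :: "real^'b^'a \<Rightarrow> real^'d^'c \<Rightarrow> real^('b \<times> 'd)^('a \<times> 'c)" where
  "kronecker A B = (\<chi> i j. A $ fst i $ fst j * B $ snd i $ snd j)"

text \<open>\<open>block_matrix A B C D\<close> is the block matrix with rows \<open>[A, B]\<close> and \<open>[C, D]\<close>.\<close>

definition block_matrix ::
  "real^'b^'a \<Rightarrow> real^'d^'a \<Rightarrow> real^'b^'c \<Rightarrow> real^'d^'c \<Rightarrow> real^('b + 'd)^('a + 'c)" where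
  "block_matrix A B C D = (\<chi> i j.
     case i of
       Inl p \<Rightarrow> (case j of Inl q \<Rightarrow> A $ p $ q | Inr q \<Rightarrow> B $ p $ q)
     | Inr p \<Rightarrow> (case j of Inl q \<Rightarrow> C $ p $ q | Inr q \<Rightarrow> D $ p $ q))"

definition centering :: "real^'n^'n" where
  "centering = mat 1 - (\<chi> i j. 1 / real CARD('n))"


section \<open>Weighted graphs\<close>

definition connected_weighted_graph :: "real^'n^'n \<Rightarrow> bool" where
  "connected_weighted_graph A \<longleftrightarrow>
     (\<forall>i j. A $ i $ j \<ge> 0) \<and>
     (\<forall>i j. A $ i $ j = A $ j $ i) \<and>
     (\<forall>i j. (i, j) \<in> {(p, q). A $ p $ q > 0}\<^sup>*)"

definition laplacian :: "real^'n^'n \<Rightarrow> real^'n^'n" where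
  "laplacian A = (\<chi> i j. if i = j then \<Sum>k\<in>UNIV. A $ i $ k else 0) - A"

text \<open>The index types \<open>'n\<close>, \<open>'m\<close>, \<open>'d\<close> have \<open>N\<close>, \<open>N - 1\<close> and \<open>d\<close> elements.\<close>

definition E_matrix ::
  "real \<Rightarrow> real \<Rightarrow> real \<Rightarrow> real^'n^'n \<Rightarrow> real^'m^'n
    \<Rightarrow> real^('d::finite + ('m \<times> 'd + 'm \<times> 'd))^('d + ('m \<times> 'd + 'm \<times> 'd))" where
  "E_matrix \<alpha> \<beta> \<phi> L R = (1/2) *\<^sub>R
     block_matrix
       ((\<alpha> * (\<phi> + 1)) *\<^sub>R mat 1) 0
       0 (block_matrix
            ((\<alpha> * (\<phi> + 1)) *\<^sub>R mat 1) (mat 1)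
            (mat 1) ((1 / \<alpha>) *\<^sub>R mat 1
                     + ((\<phi> + 1) / \<beta>) *\<^sub>R kronecker (matrix_inv (transpose R ** L ** R)) (mat 1)))"


section \<open>Functions\<close>

text \<open>\<open>g\<close> is the gradient of the function whose strong convexity is meant.\<close>

definition strongly_convex_grad :: "real \<Rightarrow> ('a::real_inner \<Rightarrow> 'a) \<Rightarrow> bool" where
  "strongly_convex_grad m g \<longleftrightarrow> (\<forall>x z. (z - x) \<bullet> (g z - g x) \<ge> m * (norm (z - x))\<^sup>2)"


section \<open>The event-triggered system\<close>

text \<open>A state of the network is a vector of \<open>N\<close> vectors in \<open>\<real>\<^sup>d\<close>; its norm is the Euclidean norm of
  the stacked vector. \<open>disagreement\<close> is the action of \<open>centering \<otimes> I\<^sub>d\<close> on such states.\<close>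

definition disagreement :: "(real^'d)^'n \<Rightarrow> (real^'d)^'n" where
  "disagreement x = (\<chi> i. \<Sum>j\<in>UNIV. (centering :: real^'n^'n) $ i $ j *\<^sub>R x $ j)"

text \<open>\<open>(X, V)\<close> is the trajectory on \<open>[s0, \<infinity>)\<close> that starts in \<open>(x0, v0)\<close> at time \<open>s0\<close> when the
  communicated state is held at \<open>x0\<close> for all later times.\<close>

definition held_trajectory ::
  "real^'n^'n \<Rightarrow> real \<Rightarrow> real \<Rightarrow> ('n \<Rightarrow> real^'d \<Rightarrow> real^'d) \<Rightarrow> real
    \<Rightarrow> (real^'d)^'n \<Rightarrow> (real^'d)^'n \<Rightarrow> (real \<Rightarrow> (real^'d)^'n) \<Rightarrow> (real \<Rightarrow> (real^'d)^'n) \<Rightarrow> bool" where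
  "held_trajectory A \<alpha> \<beta> g s0 x0 v0 X V \<longleftrightarrow>
     X s0 = x0 \<and> V s0 = v0 \<and>
     (\<forall>s\<ge>s0. \<forall>i.
        ((\<lambda>r. V r $ i) has_vector_derivative
           (\<alpha> * \<beta>) *\<^sub>R (\<Sum>j\<in>UNIV. A $ i $ j *\<^sub>R (x0 $ i - x0 $ j))) (at s within {s0..}) \<and>
        ((\<lambda>r. X r $ i) has_vector_derivative
           - (\<alpha> *\<^sub>R g i (X s $ i)) - \<beta> *\<^sub>R (\<Sum>j\<in>UNIV. A $ i $ j *\<^sub>R (x0 $ i - x0 $ j)) - V s $ i)
          (at s within {s0..}))"

text \<open>The next communication time after \<open>s0\<close>, where \<open>X\<close> is the trajectory held from time \<open>s0\<close> on.\<close>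

definition next_communication :: "real \<Rightarrow> real \<Rightarrow> real \<Rightarrow> (real \<Rightarrow> (real^'d)^'n) \<Rightarrow> ereal" where
  "next_communication \<tau> \<kappa> s0 X =
     (let ok = (\<lambda>s. (norm (disagreement (X s0 - X s)))\<^sup>2 \<le> \<kappa> * (norm (disagreement (X s)))\<^sup>2)
      in if \<not> ok (s0 + \<tau>) then ereal (s0 + \<tau>)
         else if \<forall>s\<ge>s0 + \<tau>. ok s then \<infinity>
         else ereal (GREATEST t. s0 + \<tau> \<le> t \<and> (\<forall>s\<in>{s0 + \<tau>..t}. ok s)))"

text \<open>\<open>T k\<close> is the \<open>k\<close>-th communication time, \<open>\<infinity>\<close> if there are at most \<open>k\<close> communications. Between
  consecutive communication times, \<open>(x, v)\<close> follows the held trajectory.\<close>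

definition event_triggered_solution ::
  "real^'n^'n \<Rightarrow> real \<Rightarrow> real \<Rightarrow> ('n \<Rightarrow> real^'d \<Rightarrow> real^'d) \<Rightarrow> real \<Rightarrow> real
    \<Rightarrow> (nat \<Rightarrow> ereal) \<Rightarrow> (real \<Rightarrow> (real^'d)^'n) \<Rightarrow> (real \<Rightarrow> (real^'d)^'n) \<Rightarrow> bool" where
  "event_triggered_solution A \<alpha> \<beta> g \<tau> \<kappa> T x v \<longleftrightarrow>
     T 0 = 0 \<and>
     (\<forall>k. T k = \<infinity> \<longrightarrow> T (Suc k) = \<infinity>) \<and>
     (\<forall>k s0. T k = ereal s0 \<longrightarrow>
        (\<exists>X V. held_trajectory A \<alpha> \<beta> g s0 (x s0) (v s0) X V \<and>
               T (Suc k) = next_communication \<tau> \<kappa> s0 X \<and>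
               (\<forall>s. s0 \<le> s \<and> ereal s \<le> T (Suc k) \<longrightarrow> x s = X s \<and> v s = V s)))"

end

theory Submission
  imports Defs
begin

text \<open>Let \<open>y\<close> be the deviation of \<open>x\<close> from the constant state \<open>xstar\<close>, \<open>q\<close> the deviation of \<open>v\<close> from its
  equilibrium value, \<open>h\<close> the gradient increment, and \<open>U = \<alpha> h + q\<close>, so that \<open>y' = - U - \<beta> L x0\<close>, where
  \<open>x0\<close> is the held state. The quadratic form of \<open>E\<close> in \<open>(y, q)\<close> is a Lyapunov function: its derivative is
  at most \<open>- \<delta>/2 |y|\<^sup>2 - 1/2 |U|\<^sup>2 - 1/2 |q|\<^sup>2\<close> plus terms in the disagreement and the sampling error
  \<open>e = \<Pi> (x0 - x)\<close>. After the dwell time \<open>\<tau>\<close> the trigger bounds \<open>e\<close> by the disagreement. Before it,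
  Gronwall's inequality run backwards from the current time gives
  \<open>|e|\<^sup>2 \<le> \<zeta>\<^sup>2 (|U|\<^sup>2 + |\<Pi> x|\<^sup>2)\<close>. This bound does not involve the mean of \<open>y\<close>, which decays at
  rate \<open>\<delta>\<close> without any margin.\<close>

section \<open>Self-adjoint operators\<close>

text \<open>The weights in E are dictated by cancellations. The weight 1/\<alpha> on |q|^2 makes its
  derivative remove the term -\<beta> q \<bullet> L x0 that y' brings into the derivative of y
  \<bullet> q. The block with the inverse of R^T L R acts on states as an operator \<open>J\<close>
  with J L = \<Pi>. Its derivative is \<alpha> (\<phi> + 1) q \<bullet> \<Pi> x0, which removes the
  indefinite term -\<alpha> (\<phi> + 1) y \<bullet> q and leaves only q \<bullet> e. The coupling
  then survives as -\<alpha> \<beta> \<phi> y \<bullet> L x0, so \<phi> > 0 is the strength of the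
  consensus dissipation. The value of \<phi> is the one with \<alpha>^2 (\<phi> + 1) mmin =
  (\<alpha>^2 Mmax^2 + \<delta>) / 2: strong monotonicity pays for \<alpha>^2 |h|^2 / 2, which
  completes the square |U|^2 / 2, and \<delta>/2 |y|^2 remains. The cancellation requires q to have
  zero mean. This holds initially, as the v sum to zero and so do the gradients at the minimizer,
  and it is preserved because L x0 has zero mean. The factor 1/4 in the rate is two halvings: the
  decay of W carries 1/2, and W is quadratic in y.\<close>

lemma selfadjoint_min_eigenvector:
  fixes f :: "'a::euclidean_space \<Rightarrow> 'a"
  assumes lin: "linear f" and sa: "\<And>x y. f x \<bullet> y = x \<bullet> f y"
    and U: "subspace U" "\<And>x. x \<in> U \<Longrightarrow> f x \<in> U" "u0 \<in> U" "u0 \<noteq> 0"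
  obtains c v where "v \<in> U" "v \<noteq> 0" "f v = c *\<^sub>R v" "\<And>w. w \<in> U \<Longrightarrow> c * (norm w)\<^sup>2 \<le> w \<bullet> f w"
proof -
  have cont: "continuous_on S f" for S
    using lin by (simp add: linear_continuous_on linear_conv_bounded_linear)
  let ?K = "sphere 0 1 \<inter> U"
  have "compact ?K"
    using closed_subspace[OF U(1)] by (simp add: compact_Int_closed)
  moreover have "(1 / norm u0) *\<^sub>R u0 \<in> ?K"
    using U by (simp add: subspace_scale)
  ultimately obtain v where v: "v \<in> ?K" and min: "\<And>w. w \<in> ?K \<Longrightarrow> v \<bullet> f v \<le> w \<bullet> f w"
    using continuous_attains_inf[of ?K "\<lambda>w. w \<bullet> f w"] cont by (fastforce intro: continuous_intros)
  define c where "c = v \<bullet> f v"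
  have bound: "c * (norm w)\<^sup>2 \<le> w \<bullet> f w" if "w \<in> U" for w
  proof (cases "w = 0")
    case False
    have "(1 / norm w) *\<^sub>R w \<in> ?K"
      using U that False by (simp add: subspace_scale)
    from min[OF this] have "c \<le> (w \<bullet> f w) / (norm w)\<^sup>2"
      by (simp add: c_def linear_cmul[OF lin] power2_eq_square)
    then show ?thesis using False by (simp add: field_simps)
  qed (simp add: linear_0[OF lin])
  \<comment> \<open>\<open>u\<close> is the residual of the minimizer \<open>v\<close> of the
    Rayleigh quotient. Replacing \<open>v\<close> by \<open>v - t u\<close> changes w \<bullet> f w
    - c |w|^2 by -2 t |u|^2 + t^2 k, which must stay nonnegative for every \<open>t\<close>.\<close>
  define u where "u = f v - c *\<^sub>R v"
  have uU: "u \<in> U" unfolding u_def using U v by (simp add: subspace_diff subspace_scale)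
  define k where "k = u \<bullet> f u - c * (u \<bullet> u)"
  have ineq: "2 * t * (u \<bullet> u) \<le> t\<^sup>2 * k" for t
  proof -
    have vv: "v \<bullet> v = 1" using v by (simp add: norm_eq_1)
    have vf: "v \<bullet> f u = f v \<bullet> u" by (simp add: sa)
    have fv: "f v \<bullet> u = u \<bullet> u + c * (v \<bullet> u)" by (simp add: u_def inner_diff_left)
    have "v - t *\<^sub>R u \<in> U" using U v uU by (simp add: subspace_diff subspace_scale)
    from bound[OF this] show ?thesis
      unfolding power2_norm_eq_inner
      by (simp add: linear_diff[OF lin] linear_cmul[OF lin] inner_diff_left
          inner_diff_right vv vf fv c_def[symmetric] k_def power2_eq_square algebra_simps
          inner_commute[of u "f v"] inner_commute[of u v])
  qed
  have "u \<bullet> u = 0"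
  proof (rule ccontr)
    assume "u \<bullet> u \<noteq> 0"
    then have pos: "u \<bullet> u > 0" by simp
    \<comment> \<open>Chosen so that \<open>t * k\<close> is at most \<open>u \<bullet> u\<close>;
      the first-order gain then outweighs the second-order term.\<close>
    define t where "t = (u \<bullet> u) / (\<bar>k\<bar> + 1)"
    have t: "t > 0" unfolding t_def using pos by (simp add: divide_pos_pos)
    have "2 * (u \<bullet> u) \<le> t * k"
      using ineq[of t] t by (simp add: power2_eq_square mult.assoc)
    also have "\<dots> \<le> t * (\<bar>k\<bar> + 1)" using t by (intro mult_left_mono) auto
    also have "\<dots> = u \<bullet> u" by (simp add: t_def)
    finally show False using pos by simp
  qed
  then have "f v = c *\<^sub>R v" by (simp add: u_def)
  moreover have "v \<noteq> 0" using v by auto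
  ultimately show ?thesis using that v bound by blast
qed

lemma matrix_inner_symmetric:
  fixes B :: "real^'n^'n"
  assumes "transpose B = B"
  shows "(B *v x) \<bullet> y = x \<bullet> (B *v y)"
  using dot_lmul_matrix[of x B y] transpose_matrix_vector[of B x] by (simp add: assms)

text \<open>Eigenvectors of distinct eigenvalues are orthogonal, hence independent. Finiteness is
  what makes \<open>Max\<close> over the eigenvalues an upper bound.\<close>

lemma finite_eigenvalues_symmetric:
  fixes B :: "real^'n^'n"
  assumes sym: "transpose B = B"
  shows "finite {c. eigenvalue B c}"
proof -
  define w where "w c = (SOME v. v \<noteq> 0 \<and> B *v v = c *\<^sub>R v)" for c
  have w: "w c \<noteq> 0 \<and> B *v w c = c *\<^sub>R w c" if "eigenvalue B c" for c
    unfolding w_def by (rule someI_ex) (use that in \<open>auto simp: eigenvalue_def\<close>)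
  have orth: "w c \<bullet> w c' = 0" if "eigenvalue B c" "eigenvalue B c'" "c \<noteq> c'" for c c'
  proof -
    have "c * (w c \<bullet> w c') = c' * (w c \<bullet> w c')"
      using matrix_inner_symmetric[OF sym, of "w c" "w c'"] w that by simp
    then show ?thesis using that by simp
  qed
  have "inj_on w {c. eigenvalue B c}"
    using orth w by (intro inj_onI) (metis inner_eq_zero_iff mem_Collect_eq)
  moreover have "pairwise orthogonal (w ` {c. eigenvalue B c})"
    unfolding pairwise_def orthogonal_def using orth by auto
  then have "independent (w ` {c. eigenvalue B c})"
    by (rule pairwise_orthogonal_independent) (use w in auto)
  then have "finite (w ` {c. eigenvalue B c})"
    by (rule independent_imp_finite)
  ultimately show ?thesis by (simp add: finite_image_iff)
qed

text \<open>The minimal eigenvector of -B on the whole space is a maximal one of B. Used for both E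
  and the Laplacian.\<close>

lemma rayleigh_le_Max_eigenvalue:
  fixes B :: "real^'n^'n"
  assumes sym: "transpose B = B"
  shows "w \<bullet> (B *v w) \<le> Max {c. eigenvalue B c} * (norm w)\<^sup>2"
proof -
  have "axis undefined 1 \<noteq> (0 :: real^'n)" by (simp add: axis_eq_0_iff)
  moreover have "linear (\<lambda>x. - (B *v x))"
    by (intro linear_compose_neg matrix_vector_mul_linear)
  moreover have "- (B *v x) \<bullet> y = x \<bullet> - (B *v y)" for x y
    by (simp add: matrix_inner_symmetric[OF sym])
  ultimately obtain c v where cv: "v \<noteq> 0" "- (B *v v) = c *\<^sub>R v"
    "\<And>w. c * (norm w)\<^sup>2 \<le> w \<bullet> - (B *v w)"
    by - (rule selfadjoint_min_eigenvector[of "\<lambda>x. - (B *v x)" UNIV "axis undefined 1"], auto)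
  have "B *v v = (- c) *\<^sub>R v" using cv(2) by (metis minus_equation_iff scaleR_minus_left)
  then have "eigenvalue B (- c)" using cv(1) unfolding eigenvalue_def by blast
  then have "- c \<le> Max {c. eigenvalue B c}"
    using finite_eigenvalues_symmetric[OF sym] by simp
  then have "- c * (norm w)\<^sup>2 \<le> Max {c. eigenvalue B c} * (norm w)\<^sup>2"
    by (intro mult_right_mono) auto
  with cv(3)[of w] show ?thesis by simp
qed

text \<open>Testing semidefiniteness at c w - B w gives c |B w|^2 \<le> c^2 w \<bullet> B w, which
  the upper bound on the form finishes. This avoids a square root of B and an eigenbasis.\<close>

lemma psd_norm_bound:
  fixes B :: "real^'n^'n"
  assumes sym: "transpose B = B" and psd: "\<And>w. 0 \<le> w \<bullet> (B *v w)"
    and up: "\<And>w. w \<bullet> (B *v w) \<le> c * (norm w)\<^sup>2" and c: "c \<ge> 0"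
  shows "norm (B *v w) \<le> c * norm w"
proof (cases "c = 0 \<or> w = 0")
  case False
  then have c: "c > 0" using c by simp
  define u where "u = B *v w"
  have "0 \<le> (c *\<^sub>R w - u) \<bullet> (B *v (c *\<^sub>R w - u))" by (rule psd)
  also have "\<dots> = c\<^sup>2 * (w \<bullet> u) - 2 * c * (u \<bullet> u) + u \<bullet> (B *v u)"
    using matrix_inner_symmetric[OF sym, of w u]
    by (simp add: matrix_vector_mult_diff_distrib matrix_vector_mult_scaleR inner_diff_left
        inner_diff_right u_def[symmetric] power2_eq_square algebra_simps inner_commute[of u w])
  also have "\<dots> \<le> c\<^sup>2 * (c * (norm w)\<^sup>2) - 2 * c * (u \<bullet> u) + c * (u \<bullet> u)"
  proof -
    have "c\<^sup>2 * (w \<bullet> u) \<le> c\<^sup>2 * (c * (norm w)\<^sup>2)"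
      unfolding u_def by (intro mult_left_mono up) simp
    moreover have "u \<bullet> (B *v u) \<le> c * (u \<bullet> u)" using up[of u] by (simp only: power2_norm_eq_inner)
    ultimately show ?thesis by linarith
  qed
  finally have "c * (u \<bullet> u) \<le> c\<^sup>2 * (c * (norm w)\<^sup>2)" by linarith
  also have "\<dots> = c * (c * norm w)\<^sup>2" by (simp add: power2_eq_square)
  finally have "u \<bullet> u \<le> (c * norm w)\<^sup>2" using c mult_le_cancel_left_pos by blast
  then have "(norm u)\<^sup>2 \<le> (c * norm w)\<^sup>2" by (simp only: power2_norm_eq_inner)
  moreover have "0 \<le> c * norm w" using c by simp
  ultimately show ?thesis unfolding u_def by (rule power2_le_imp_le)
next
  case True
  show ?thesis
  proof (cases "w = 0")
    case False
    with True have c0: "c = 0" by simp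
    have z: "x \<bullet> (B *v x) = 0" for x using up[of x] psd[of x] c0 by simp
    \<comment> \<open>For c = 0 the form vanishes identically, and its value at w + B w isolates |B
      w|^2.\<close>
    have "0 = (w + B *v w) \<bullet> (B *v (w + B *v w))" using z by simp
    also have "\<dots> = 2 * ((B *v w) \<bullet> (B *v w))"
      using z[of w] z[of "B *v w"] matrix_inner_symmetric[OF sym, of w "B *v w"]
      by (simp add: matrix_vector_right_distrib inner_add_left inner_add_right)
    finally show ?thesis using c0 by simp
  qed simp
qed

section \<open>The Laplacian of a connected graph\<close>

lemma laplacian_mult:
  "(laplacian A *v x) $ i = (\<Sum>j\<in>UNIV. A $ i $ j * (x $ i - x $ j))"
proof -
  have "(laplacian A *v x) $ i
      = (\<Sum>j\<in>UNIV. (if i = j then (\<Sum>k\<in>UNIV. A $ i $ k) * x $ j else 0) - A $ i $ j * x $ j)"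
    unfolding laplacian_def matrix_vector_mult_def
    by (auto intro!: sum.cong simp: left_diff_distrib)
  also have "\<dots> = (\<Sum>j\<in>UNIV. A $ i $ j * (x $ i - x $ j))"
    by (simp add: sum_subtractf right_diff_distrib sum_distrib_right)
  finally show ?thesis .
qed

lemma laplacian_symmetric:
  assumes "connected_weighted_graph A"
  shows "transpose (laplacian A) = laplacian A"
  using assms by (auto simp: connected_weighted_graph_def laplacian_def transpose_def vec_eq_iff)

lemma laplacian_one: "laplacian A *v 1 = 0"
  by (simp add: vec_eq_iff laplacian_mult)

lemma laplacian_quadratic:
  assumes "connected_weighted_graph A"
  shows "x \<bullet> (laplacian A *v x) = (\<Sum>i\<in>UNIV. \<Sum>j\<in>UNIV. A $ i $ j * (x $ i - x $ j)\<^sup>2) / 2"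
proof -
  have sym: "A $ i $ j = A $ j $ i" for i j
    using assms by (auto simp: connected_weighted_graph_def)
  have 1: "x \<bullet> (laplacian A *v x) = (\<Sum>i\<in>UNIV. \<Sum>j\<in>UNIV. A $ i $ j * (x $ i - x $ j) * x $ i)"
    by (simp add: inner_vec_def laplacian_mult sum_distrib_left mult_ac)
  \<comment> \<open>Exchanging the summation indices and using symmetry of A turns the factor
    \<open>x $ i\<close> into \<open>- x $ j\<close>; adding both versions produces the
    square.\<close>
  have 2: "x \<bullet> (laplacian A *v x) = (\<Sum>i\<in>UNIV. \<Sum>j\<in>UNIV. - (A $ i $ j * (x $ i - x $ j) * x $ j))"
    unfolding 1 by (subst sum.swap, intro sum.cong refl, subst sym) (simp add: algebra_simps)
  have "2 * (x \<bullet> (laplacian A *v x)) = (\<Sum>i\<in>UNIV. \<Sum>j\<in>UNIV. A $ i $ j * (x $ i - x $ j)\<^sup>2)"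
    unfolding mult_2 by (subst 1, subst 2)
      (simp add: sum.distrib[symmetric] power2_eq_square algebra_simps)
  then show ?thesis by simp
qed

lemma laplacian_psd:
  assumes "connected_weighted_graph A"
  shows "0 \<le> x \<bullet> (laplacian A *v x)"
  using assms unfolding laplacian_quadratic[OF assms] connected_weighted_graph_def
  by (auto intro!: sum_nonneg divide_nonneg_nonneg)

text \<open>The form is a sum of nonnegative edge terms, so values agree across every edge of
  positive weight and, by connectivity, along a path between any two nodes.\<close>

lemma laplacian_kernel:
  assumes G: "connected_weighted_graph A" and 0: "x \<bullet> (laplacian A *v x) = 0"
  shows "x $ i = x $ j"
proof -
  have nn: "0 \<le> A $ i $ j * (x $ i - x $ j)\<^sup>2" for i j
    using G by (auto simp: connected_weighted_graph_def)
  have "(\<Sum>i\<in>UNIV. \<Sum>j\<in>UNIV. A $ i $ j * (x $ i - x $ j)\<^sup>2) = 0"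
    using 0 by (simp add: laplacian_quadratic[OF G])
  then have z: "A $ i $ j * (x $ i - x $ j)\<^sup>2 = 0" for i j
    using nn by (simp add: sum_nonneg_eq_0_iff sum_nonneg)
  have "(i, j) \<in> {(p, q). A $ p $ q > 0}\<^sup>*" using G by (auto simp: connected_weighted_graph_def)
  then show ?thesis
    by (induction rule: rtrancl_induct) (use z in force)+
qed

text \<open>Links the roots of the characteristic polynomial, by which \<open>lam\<close> is given,
  to eigenvectors, which the variational arguments produce.\<close>

lemma ordered_eigenvalues_iff:
  fixes A :: "real^'n^'n"
  assumes "ordered_eigenvalues A lam"
  shows "eigenvalue A c \<longleftrightarrow> (\<exists>k\<in>{1..CARD('n)}. lam k = c)"
proof -
  have "mat c *v v = c *\<^sub>R v" for v :: "real^'n"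
    by (simp add: vec_eq_iff mat_def matrix_vector_mult_def if_distrib[of "\<lambda>a. a * _"] cong: if_cong)
  then have "eigenvalue A c \<longleftrightarrow> (\<exists>v. v \<noteq> 0 \<and> (mat c - A) *v v = 0)"
    by (auto simp: eigenvalue_def matrix_vector_mult_diff_rdistrib)
  also have "\<dots> \<longleftrightarrow> det (mat c - A) = 0"
    using matrix_left_invertible_ker[of "mat c - A"] invertible_left_inverse[of "mat c - A"]
      invertible_det_nz[of "mat c - A"] by auto
  also have "\<dots> \<longleftrightarrow> (\<exists>k\<in>{1..CARD('n)}. lam k = c)"
    using assms by (auto simp: ordered_eigenvalues_def)
  finally show ?thesis .
qed

lemma subspace_sum_zero: "subspace {x :: real^'n. (\<Sum>i\<in>UNIV. x $ i) = 0}"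
  by (rule subspaceI) (simp_all add: sum.distrib sum_distrib_left[symmetric])

lemma laplacian_sum_zero:
  assumes "connected_weighted_graph A"
  shows "(\<Sum>i\<in>UNIV. (laplacian A *v x) $ i) = 0"
proof -
  have "(\<Sum>i\<in>UNIV. (laplacian A *v x) $ i) = 1 \<bullet> (laplacian A *v x)"
    by (simp add: inner_vec_def)
  also have "\<dots> = 0"
    using matrix_inner_symmetric[OF laplacian_symmetric[OF assms], of 1 x] by (simp add: laplacian_one)
  finally show ?thesis .
qed

text \<open>The Rayleigh minimum c over zero-sum vectors is a positive eigenvalue, whereas
  \<open>lam 1\<close> is 0, so c occurs at an index of at least 2 and dominates
  \<open>lam 2\<close>. Only \<open>0 \<le> lam 2\<close> is stated: since \<open>lam\<close> counts
  algebraic multiplicities, strictness would require that 0 is a simple root.\<close>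

lemma
  fixes A :: "real^'n^'n"
  assumes N: "CARD('n) \<ge> 2" and G: "connected_weighted_graph A"
    and lam: "ordered_eigenvalues (laplacian A) lam"
  shows second_eigenvalue_nonneg: "0 \<le> lam 2"
    and second_le_last_eigenvalue: "lam 2 \<le> lam CARD('n)"
    and second_eigenvalue_le_quadratic:
      "(\<Sum>i\<in>UNIV. w $ i) = 0 \<Longrightarrow> lam 2 * (norm w)\<^sup>2 \<le> w \<bullet> (laplacian A *v w)"
    and norm_laplacian_le: "norm (laplacian A *v w) \<le> lam CARD('n) * norm w"
proof -
  let ?L = "laplacian A"
  note sym = laplacian_symmetric[OF G]
  note sa = matrix_inner_symmetric[OF sym]
  note eig = ordered_eigenvalues_iff[OF lam]
  have mono: "lam i \<le> lam j" if "i \<in> {1..CARD('n)}" "j \<in> {1..CARD('n)}" "i \<le> j" for i j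
    using lam that unfolding ordered_eigenvalues_def mono_on_def by blast
  have nonneg: "0 \<le> c" if ev: "eigenvalue ?L c" for c
  proof -
    obtain v where v: "v \<noteq> 0" "?L *v v = c *\<^sub>R v"
      using ev unfolding eigenvalue_def by blast
    have "0 \<le> c * (v \<bullet> v)" using laplacian_psd[OF G, of v] unfolding v(2) by simp
    then show ?thesis using v(1) by (metis inner_gt_zero_iff zero_le_mult_iff not_le)
  qed
  have eig_lam: "eigenvalue ?L (lam k)" if "k \<in> {1..CARD('n)}" for k using eig that by blast
  show lam2: "0 \<le> lam 2" using N by (intro nonneg eig_lam) simp
  show le: "lam 2 \<le> lam CARD('n)" using N by (intro mono) auto
  have fin: "finite {c. eigenvalue ?L c}" by (rule finite_eigenvalues_symmetric[OF sym])
  have "eigenvalue ?L (lam CARD('n))" using N by (intro eig_lam) simp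
  moreover have "c \<le> lam CARD('n)" if ev: "eigenvalue ?L c" for c
  proof -
    obtain k where "k \<in> {1..CARD('n)}" "lam k = c" using ev eig by blast
    then show ?thesis using mono[of k "CARD('n)"] by auto
  qed
  ultimately have "Max {c. eigenvalue ?L c} = lam CARD('n)"
    using fin by (intro Max_eqI) auto
  then have "w \<bullet> (?L *v w) \<le> lam CARD('n) * (norm w)\<^sup>2" for w
    using rayleigh_le_Max_eigenvalue[OF sym, of w] by simp
  then show "norm (?L *v w) \<le> lam CARD('n) * norm w"
    by (intro psd_norm_bound sym laplacian_psd[OF G]) (use lam2 le in auto)
  let ?U = "{x :: real^'n. (\<Sum>i\<in>UNIV. x $ i) = 0}"
  obtain i j :: 'n where ij: "i \<noteq> j"
    using N card_le_Suc0_iff_eq[of "UNIV :: 'n set"] by fastforce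
  have u0: "axis i 1 - axis j 1 \<in> ?U" "axis i 1 - axis j 1 \<noteq> (0 :: real^'n)"
    using ij by (simp_all add: sum_subtractf axis_def vec_eq_iff) (metis one_neq_zero diff_zero)
  obtain c v where v: "v \<in> ?U" "v \<noteq> 0" "?L *v v = c *\<^sub>R v"
    "\<And>w. w \<in> ?U \<Longrightarrow> c * (norm w)\<^sup>2 \<le> w \<bullet> (?L *v w)"
    by (rule selfadjoint_min_eigenvector[OF matrix_vector_mul_linear[of ?L] sa subspace_sum_zero _ u0])
      (simp_all add: laplacian_sum_zero[OF G])
  have ev: "eigenvalue ?L c" using v unfolding eigenvalue_def by blast
  \<comment> \<open>A zero-sum eigenvector for 0 would be constant over the nodes, hence
    zero.\<close>
  have "c \<noteq> 0"
  proof
    assume "c = 0"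
    then have "v \<bullet> (?L *v v) = 0" using v by simp
    then have const: "v $ k = v $ l" for k l by (rule laplacian_kernel[OF G])
    have "(\<Sum>k\<in>UNIV. v $ k) = (\<Sum>k\<in>(UNIV::'n set). v $ i)" by (intro sum.cong const refl)
    then have "v $ i = 0" using v(1) by simp
    then show False using v(2) const by (metis vec_eq_iff zero_index)
  qed
  with nonneg[OF ev] have "c > 0" by simp
  obtain k where k: "k \<in> {1..CARD('n)}" "lam k = c" using ev eig by blast
  have "eigenvalue ?L 0"
    unfolding eigenvalue_def using laplacian_one[of A] by (intro exI[of _ 1]) auto
  then obtain l where l: "l \<in> {1..CARD('n)}" "lam l = 0" using eig by blast
  \<comment> \<open>0 is an eigenvalue, so the first entry of the ordered list is at most 0 <
    c.\<close>
  have "k \<noteq> 1" using mono[of 1 l] l k \<open>c > 0\<close> by force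
  then have "lam 2 \<le> c" using mono[of 2 k] k N by auto
  then show "lam 2 * (norm w)\<^sup>2 \<le> w \<bullet> (?L *v w)" if "(\<Sum>i\<in>UNIV. w $ i) = 0"
    using v(4)[of w] that mult_right_mono[of "lam 2" c "(norm w)\<^sup>2"] by simp
qed

section \<open>Matrices acting on states\<close>

text \<open>This is B \<otimes> I applied to stacked states, kept on vectors of vectors so that no
  product index type is needed.\<close>

definition act :: "real^'b^'a \<Rightarrow> (real^'d)^'b \<Rightarrow> (real^'d)^'a" where
  "act B x = (\<chi> i. \<Sum>j\<in>UNIV. B $ i $ j *\<^sub>R x $ j)"

text \<open>On one coordinate p across all nodes, \<open>act B\<close> is the ordinary matrix-vector
  product. Inner products and squared norms add up over p, so facts about \<open>real^'n\<close>
  lift to states slice by slice.\<close>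

definition slice :: "'d \<Rightarrow> (real^'d)^'n \<Rightarrow> real^'n" where
  "slice p x = (\<chi> i. x $ i $ p)"

lemma slice_act: "slice p (act B x) = B *v slice p x"
  by (simp add: slice_def act_def matrix_vector_mult_def vec_eq_iff)

lemma state_eqI: "(\<And>p. slice p x = slice p y) \<Longrightarrow> x = y"
  by (simp add: slice_def vec_eq_iff)

lemma inner_slice: "x \<bullet> y = (\<Sum>p\<in>UNIV. slice p x \<bullet> slice p y)"
  unfolding inner_vec_def slice_def by (simp add: sum.swap[of _ "UNIV :: 'a set"])

lemma norm_slice: "(norm x)\<^sup>2 = (\<Sum>p\<in>UNIV. (norm (slice p x))\<^sup>2)"
  unfolding power2_norm_eq_inner inner_slice[of x] ..

lemma linear_act: "linear (act B)"
  by (rule linearI)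
    (simp_all add: act_def vec_eq_iff scaleR_right_distrib sum.distrib scaleR_sum_right mult_ac)

lemma act_mult: "act (B ** C) x = act B (act C x)"
  by (rule state_eqI) (simp add: slice_act matrix_vector_mul_assoc)

lemma inner_act: "x \<bullet> act B y = act (transpose B) x \<bullet> y"
  unfolding inner_slice[of _ y] inner_slice[of x] slice_act
  by (simp add: dot_lmul_matrix)

lemma act_sum_one: "(\<Sum>i\<in>UNIV. slice p x $ i) = (\<Sum>i\<in>UNIV. x $ i) $ p"
  by (simp add: slice_def)

lemma disagreement_act: "disagreement x = act centering x"
  by (simp add: disagreement_def act_def)

lemma act_laplacian: "act (laplacian A) x $ i = (\<Sum>j\<in>UNIV. A $ i $ j *\<^sub>R (x $ i - x $ j))"
proof -
  have "slice p (act (laplacian A) x) $ i = (\<Sum>j\<in>UNIV. A $ i $ j *\<^sub>R (x $ i - x $ j)) $ p" for p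
    by (simp add: slice_act laplacian_mult) (simp add: slice_def)
  then show ?thesis by (simp add: vec_eq_iff slice_def)
qed

lemma transpose_centering: "transpose centering = centering"
  by (auto simp: centering_def transpose_def vec_eq_iff mat_def)

lemma centering_mult: "(centering *v (x :: real^'n)) $ i = x $ i - (\<Sum>j\<in>UNIV. x $ j) / real CARD('n)"
  by (simp add: centering_def matrix_vector_mult_diff_rdistrib)
    (simp add: matrix_vector_mult_def sum_divide_distrib)

lemma centering_sum_zero: "(\<Sum>i\<in>UNIV. (centering *v x) $ i) = 0"
  by (simp add: centering_mult sum_subtractf)

lemma laplacian_centering: "laplacian A *v (centering *v x) = laplacian A *v x"
  by (simp add: vec_eq_iff laplacian_mult centering_mult)

lemma centering_idem: "centering *v (centering *v x) = centering *v x"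
  unfolding vec_eq_iff centering_mult[of "centering *v x"] centering_sum_zero by simp

section \<open>Block matrices\<close>

definition join :: "'e^'a \<Rightarrow> 'e^'b \<Rightarrow> 'e^('a + 'b)" where
  "join x y = (\<chi> i. case i of Inl p \<Rightarrow> x $ p | Inr q \<Rightarrow> y $ q)"

lemma sum_UNIV_Plus:
  fixes f :: "'a::finite + 'b::finite \<Rightarrow> 'c::comm_monoid_add"
  shows "(\<Sum>i\<in>UNIV. f i) = (\<Sum>p\<in>UNIV. f (Inl p)) + (\<Sum>q\<in>UNIV. f (Inr q))"
  unfolding UNIV_Plus_UNIV[symmetric] by (subst sum.Plus) auto

lemma inner_join: "join x y \<bullet> join x' y' = x \<bullet> x' + y \<bullet> y'"
  by (simp add: inner_vec_def sum_UNIV_Plus join_def)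

lemma block_matrix_join:
  "block_matrix A B C D *v join x y = join (A *v x + B *v y) (C *v x + D *v y)"
  by (auto simp: vec_eq_iff matrix_vector_mult_def sum_UNIV_Plus join_def block_matrix_def
      split: sum.splits)

lemma transpose_block_matrix:
  "transpose (block_matrix A B C D)
    = block_matrix (transpose A) (transpose C) (transpose B) (transpose D)"
  by (auto simp: vec_eq_iff transpose_def block_matrix_def split: sum.splits)

text \<open>Carries a state isometrically to the product index type of \<open>kronecker\<close>;
  together with \<open>join\<close> it builds test vectors for E.\<close>

definition flatten :: "(real^'d)^'n \<Rightarrow> real^('n \<times> 'd)" where
  "flatten x = (\<chi> i. x $ fst i $ snd i)"

lemma sum_UNIV_Times:
  fixes f :: "'a::finite \<times> 'b::finite \<Rightarrow> 'c::comm_monoid_add"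
  shows "(\<Sum>i\<in>UNIV. f i) = (\<Sum>p\<in>UNIV. \<Sum>q\<in>UNIV. f (p, q))"
  unfolding UNIV_Times_UNIV[symmetric] by (simp add: sum.cartesian_product)

lemma inner_flatten: "flatten x \<bullet> flatten y = x \<bullet> y"
  by (simp add: inner_vec_def flatten_def sum_UNIV_Times)

lemma kronecker_flatten: "kronecker B (mat 1) *v flatten x = flatten (act B x)"
  by (auto simp: vec_eq_iff matrix_vector_mult_def kronecker_def flatten_def act_def sum_UNIV_Times
      mat_def if_distrib[of "\<lambda>a. _ * a"] if_distrib[of "\<lambda>a. a * _"] cong: if_cong)

lemma transpose_kronecker: "transpose (kronecker A B) = kronecker (transpose A) (transpose B)"
  by (simp add: vec_eq_iff transpose_def kronecker_def)

lemma transpose_add: "transpose (A + B) = transpose A + transpose B"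
  by (simp add: vec_eq_iff transpose_def)

lemma transpose_scaleR: "transpose (c *\<^sub>R A) = c *\<^sub>R transpose (A :: real^'n^'m)"
  by (simp add: vec_eq_iff transpose_def)

lemma transpose_zero: "transpose (0 :: real^'n^'m) = 0"
  by (simp add: vec_eq_iff transpose_def)

lemma scaleR_matrix_vector: "(c *\<^sub>R A) *v x = c *\<^sub>R (A *v (x :: real^'n))"
  by (simp add: vec_eq_iff matrix_vector_mult_def sum_distrib_left mult_ac)

section \<open>The Lyapunov matrix\<close>

lemma symmetric_matrix_inv:
  fixes B :: "real^'n^'n"
  assumes inv: "invertible B" and sym: "transpose B = B"
  shows "transpose (matrix_inv B) = matrix_inv B"
proof -
  have 1: "B ** matrix_inv B = mat 1" "matrix_inv B ** B = mat 1"
    using someI_ex[OF inv[unfolded invertible_def]] by (simp_all add: matrix_inv_def)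
  have "transpose (matrix_inv B) ** B = mat 1"
    using arg_cong[OF 1(1), of transpose] by (simp add: matrix_transpose_mul sym transpose_mat)
  then show ?thesis
    by (metis 1(1) matrix_mul_assoc matrix_mul_lid matrix_mul_rid)
qed

lemma transpose_E_matrix:
  fixes L :: "real^'n^'n" and R :: "real^'m^'n"
  assumes "invertible (transpose R ** L ** R)" "transpose L = L"
  shows "transpose (E_matrix \<alpha> \<beta> \<phi> L R :: real^('d::finite + ('m \<times> 'd + 'm \<times> 'd))^_) = E_matrix \<alpha> \<beta> \<phi> L R"
proof -
  have "transpose (matrix_inv (transpose R ** L ** R)) = matrix_inv (transpose R ** L ** R)"
    by (rule symmetric_matrix_inv)
      (simp_all add: assms matrix_transpose_mul transpose_transpose matrix_mul_assoc)
  then show ?thesis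
    by (simp add: E_matrix_def transpose_scaleR transpose_block_matrix transpose_add transpose_kronecker
        transpose_mat transpose_zero)
qed

lemma E_matrix_quadratic:
  fixes L :: "real^'n^'n" and R :: "real^'m^'n" and y q :: "(real^'d)^'m" and y0 :: "real^'d"
  defines "w \<equiv> join y0 (join (flatten y) (flatten q))"
  shows "w \<bullet> (E_matrix \<alpha> \<beta> \<phi> L R *v w) =
    1/2 * (\<alpha> * (\<phi> + 1) * (norm y0)\<^sup>2 + \<alpha> * (\<phi> + 1) * (norm y)\<^sup>2 + 2 * (y \<bullet> q) + 1 / \<alpha> * (norm q)\<^sup>2
      + (\<phi> + 1) / \<beta> * (q \<bullet> act (matrix_inv (transpose R ** L ** R)) q))"
    and "(norm w)\<^sup>2 = (norm y0)\<^sup>2 + (norm y)\<^sup>2 + (norm q)\<^sup>2"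
  unfolding w_def E_matrix_def
  by (simp_all add: scaleR_matrix_vector block_matrix_join inner_join matrix_vector_mult_add_rdistrib
      kronecker_flatten inner_flatten inner_add_right power2_norm_eq_inner algebra_simps inner_commute[of q y])

lemma act_laplacian_bounds:
  fixes A :: "real^'n^'n"
  assumes N: "CARD('n) \<ge> 2" and G: "connected_weighted_graph A"
    and lam: "ordered_eigenvalues (laplacian A) lam"
  shows "lam 2 * (norm (act centering x))\<^sup>2 \<le> act centering x \<bullet> act (laplacian A) (act centering x)"
    and "norm (act (laplacian A) x) \<le> lam CARD('n) * norm x"
proof -
  note bounds = second_eigenvalue_nonneg[OF N G lam] second_le_last_eigenvalue[OF N G lam]
    second_eigenvalue_le_quadratic[OF N G lam] norm_laplacian_le[OF N G lam]
  show "lam 2 * (norm (act centering x))\<^sup>2 \<le> act centering x \<bullet> act (laplacian A) (act centering x)"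
    unfolding norm_slice inner_slice slice_act sum_distrib_left
    by (intro sum_mono bounds centering_sum_zero)
  have "(norm (act (laplacian A) x))\<^sup>2 \<le> (\<Sum>p\<in>UNIV. (lam CARD('n) * norm (slice p x))\<^sup>2)"
    unfolding norm_slice slice_act by (intro sum_mono power_mono bounds) auto
  also have "\<dots> = (lam CARD('n) * norm x)\<^sup>2"
    by (simp add: power_mult_distrib sum_distrib_left norm_slice[of x])
  finally show "norm (act (laplacian A) x) \<le> lam CARD('n) * norm x"
    by (rule power2_le_imp_le) (use bounds(1,2) in simp)
qed

definition lyapunov :: "real \<Rightarrow> real \<Rightarrow> real \<Rightarrow> real^'n^'n \<Rightarrow> (real^'d)^'n \<Rightarrow> (real^'d)^'n \<Rightarrow> real" where
  "lyapunov \<alpha> \<beta> \<phi> J y q = 1/2 * (\<alpha> * (\<phi> + 1) * (norm y)\<^sup>2 + 2 * (y \<bullet> q) + 1 / \<alpha> * (norm q)\<^sup>2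
      + (\<phi> + 1) / \<beta> * (q \<bullet> act J q))"

locale reduction =
  fixes A :: "real^'n^'n" and R :: "real^'m^'n" and lam :: "nat \<Rightarrow> real"
  assumes N: "CARD('n) \<ge> 2" and G: "connected_weighted_graph A"
    and lam: "ordered_eigenvalues (laplacian A) lam"
    and lam2_pos: "lam 2 > 0"
    and R: "1 v* R = 0" "transpose R ** R = mat 1" "R ** transpose R = centering"
begin

definition S where "S = transpose R ** laplacian A ** R"
text \<open>The pseudoinverse of the Laplacian: it inverts L on zero-sum vectors and kills
  constants.\<close>

definition J where "J = R ** matrix_inv S ** transpose R"

text \<open>R is an isometry whose range consists of zero-sum vectors, where the Laplacian is
  bounded below by \<open>lam 2\<close>.\<close>

lemma S_coercive: "lam 2 * (norm w)\<^sup>2 \<le> w \<bullet> (S *v w)"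
proof -
  have "(\<Sum>i\<in>UNIV. (R *v w) $ i) = 1 \<bullet> (R *v w)" by (simp add: inner_vec_def)
  also have "\<dots> = 0" using dot_lmul_matrix[of 1 R w] R(1) by simp
  finally have "lam 2 * (norm (R *v w))\<^sup>2 \<le> (R *v w) \<bullet> (laplacian A *v (R *v w))"
    by (rule second_eigenvalue_le_quadratic[OF N G lam])
  moreover have "(R *v w) \<bullet> u = w \<bullet> (transpose R *v u)" for u
    using dot_lmul_matrix[of u R w] by (simp add: inner_commute)
  ultimately show ?thesis
    by (simp add: power2_norm_eq_inner S_def matrix_vector_mul_assoc R(2) matrix_mul_assoc
        del: transpose_matrix_vector)
qed

lemma transpose_S: "transpose S = S"
  by (simp add: S_def matrix_transpose_mul transpose_transpose matrix_mul_assoc laplacian_symmetric[OF G])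

lemma S_injective: "S *v w = 0 \<Longrightarrow> w = 0"
  using S_coercive[of w] lam2_pos by (simp add: mult_le_0_iff)

lemma invertible_S: "invertible S"
  using S_injective matrix_left_invertible_ker[of S] invertible_left_inverse[of S] by blast

lemma S_inverse: "S ** matrix_inv S = mat 1" "matrix_inv S ** S = mat 1"
  using someI_ex[OF invertible_S[unfolded invertible_def]] by (simp_all add: matrix_inv_def)

lemma transpose_J: "transpose J = J"
  by (simp add: J_def matrix_transpose_mul transpose_transpose matrix_mul_assoc
      symmetric_matrix_inv[OF invertible_S transpose_S])

text \<open>As L annihilates constants, R R^T may be inserted to its right. Then S appears next to
  its inverse, and only R R^T, the centering, is left.\<close>

lemma J_laplacian: "act J (act (laplacian A) x) = act centering x"
proof -
  have "laplacian A ** centering = laplacian A"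
    by (simp add: matrix_eq matrix_vector_mul_assoc[symmetric] laplacian_centering)
  then have "J ** laplacian A = J ** (laplacian A ** (R ** transpose R))" by (simp add: R)
  also have "\<dots> = R ** (matrix_inv S ** S) ** transpose R"
    by (simp add: J_def S_def matrix_mul_assoc)
  finally show ?thesis by (simp add: S_inverse R act_mult[symmetric])
qed

lemma inner_J: "q \<bullet> act J q = act (transpose R) q \<bullet> act (matrix_inv S) (act (transpose R) q)"
  by (simp add: J_def act_mult inner_act[of _ R])

lemma J_psd:
  fixes q :: "(real^'d)^'n"
  shows "0 \<le> q \<bullet> act J q"
proof -
  have "0 \<le> u \<bullet> (matrix_inv S *v u)" for u
  proof -
    \<comment> \<open>Writing u = S w with w = S^-1 u turns the form of the inverse into the form of
      S at w.\<close>
    have "0 \<le> (matrix_inv S *v u) \<bullet> (S *v (matrix_inv S *v u))"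
      using S_coercive[of "matrix_inv S *v u"] lam2_pos by (smt (verit) zero_le_mult_iff zero_le_power2)
    then show ?thesis by (simp add: matrix_vector_mul_assoc S_inverse inner_commute)
  qed
  then show ?thesis
    unfolding inner_J inner_slice[of "act (transpose R) q"] slice_act by (intro sum_nonneg)
qed

text \<open>Splitting \<alpha> (\<phi> + 1) as \<alpha> + \<alpha> \<phi>, the first share completes
  the square |\<alpha> y + q|^2 / \<alpha> and the second is the claimed bound.\<close>

lemma lyapunov_lower:
  assumes "\<alpha> > 0" "\<beta> > 0" "\<phi> > 0"
  shows "\<alpha> * \<phi> / 2 * (norm y)\<^sup>2 \<le> lyapunov \<alpha> \<beta> \<phi> J y q"
proof -
  have "0 \<le> 1 / \<alpha> * (norm (\<alpha> *\<^sub>R y + q))\<^sup>2" using assms by simp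
  also have "\<dots> = \<alpha> * (norm y)\<^sup>2 + 2 * (y \<bullet> q) + 1 / \<alpha> * (norm q)\<^sup>2"
    using assms by (simp add: power2_norm_eq_inner inner_add_left inner_add_right field_simps
        inner_commute[of q y])
  finally have 1: "0 \<le> \<alpha> * (norm y)\<^sup>2 + 2 * (y \<bullet> q) + 1 / \<alpha> * (norm q)\<^sup>2" .
  have 2: "0 \<le> (\<phi> + 1) / \<beta> * (q \<bullet> act J q)" using assms J_psd[of q] by simp
  have "2 * lyapunov \<alpha> \<beta> \<phi> J y q = \<alpha> * \<phi> * (norm y)\<^sup>2
      + (\<alpha> * (norm y)\<^sup>2 + 2 * (y \<bullet> q) + 1 / \<alpha> * (norm q)\<^sup>2) + (\<phi> + 1) / \<beta> * (q \<bullet> act J q)"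
    by (simp add: lyapunov_def algebra_simps)
  with 1 2 show ?thesis by simp
qed

lemma E_matrix_bounds:
  fixes y q :: "(real^'d)^'n" and \<alpha> \<beta> \<phi> :: real
  defines "c \<equiv> Max {c. eigenvalue (E_matrix \<alpha> \<beta> \<phi> (laplacian A) R
      :: real^('d + ('m \<times> 'd + 'm \<times> 'd))^('d + ('m \<times> 'd + 'm \<times> 'd))) c}"
  shows lyapunov_upper: "act centering q = q \<Longrightarrow> lyapunov \<alpha> \<beta> \<phi> J y q \<le> c * ((norm y)\<^sup>2 + (norm q)\<^sup>2)"
    and Max_eigenvalue_E_ge: "\<alpha> * (\<phi> + 1) / 2 \<le> c"
proof -
  let ?E = "E_matrix \<alpha> \<beta> \<phi> (laplacian A) R :: real^('d + ('m \<times> 'd + 'm \<times> 'd))^('d + ('m \<times> 'd + 'm \<times> 'd))"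
  have "transpose ?E = ?E"
    using invertible_S laplacian_symmetric[OF G] unfolding S_def by (rule transpose_E_matrix)
  then have ray: "w \<bullet> (?E *v w) \<le> c * (norm w)\<^sup>2" for w
    unfolding c_def by (rule rayleigh_le_Max_eigenvalue)
  have "act B 0 = 0" for B :: "real^'m^'m" by (rule linear_0[OF linear_act])
  \<comment> \<open>The test vector lies in the first block, where E is the scalar \<alpha> (\<phi>
    + 1) / 2; this is later the source of \<open>lamE > 0\<close>.\<close>
  then show "\<alpha> * (\<phi> + 1) / 2 \<le> c"
    using ray[of "join (axis undefined 1) (join (flatten 0) (flatten 0))"] unfolding E_matrix_quadratic
    by (simp add: flatten_def zero_vec_def[symmetric])
  assume q: "act centering q = q"
  \<comment> \<open>The coordinate of y along the normalized vector of ones. The factor 1 / sqrt N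
    makes y \<mapsto> (y0, R^T y) norm preserving; q needs no such coordinate, having zero
    mean.\<close>
  define y0 where "y0 = (1 / sqrt CARD('n)) *\<^sub>R (\<Sum>i\<in>UNIV. y $ i)"
  let ?w = "join y0 (join (flatten (act (transpose R) y)) (flatten (act (transpose R) q)))"
  have RR: "act (transpose R) u \<bullet> act (transpose R) u' = u \<bullet> act centering u'" for u u' :: "(real^'d)^'n"
    by (simp add: inner_act[symmetric] act_mult[symmetric] R)
  have "slice p y \<bullet> slice p y = y0 $ p * y0 $ p + slice p y \<bullet> (centering *v slice p y)" for p
  proof -
    have "slice p y \<bullet> slice p y - slice p y \<bullet> (centering *v slice p y)
        = (\<Sum>i\<in>UNIV. slice p y $ i) * ((\<Sum>i\<in>UNIV. slice p y $ i) / real CARD('n))"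
      unfolding inner_diff_right[symmetric] by (simp add: inner_vec_def centering_mult sum_distrib_right sum_divide_distrib)
    also have "\<dots> = y0 $ p * y0 $ p"
      by (simp add: y0_def act_sum_one)
    finally show ?thesis by simp
  qed
  then have "y \<bullet> y = y0 \<bullet> y0 + y \<bullet> act centering y"
    by (simp add: inner_slice slice_act inner_vec_def[of y0] sum.distrib)
  then have ny: "(norm y)\<^sup>2 = (norm y0)\<^sup>2 + (norm (act (transpose R) y))\<^sup>2"
    by (simp add: power2_norm_eq_inner RR)
  have nq: "(norm q)\<^sup>2 = (norm (act (transpose R) q))\<^sup>2"
    by (simp add: power2_norm_eq_inner RR q)
  have "lyapunov \<alpha> \<beta> \<phi> J y q = ?w \<bullet> (?E *v ?w)"
    unfolding E_matrix_quadratic S_def[symmetric] lyapunov_def inner_J RR q ny nq by (simp add: algebra_simps)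
  also have "\<dots> \<le> c * (norm ?w)\<^sup>2" by (rule ray)
  also have "\<dots> = c * ((norm y)\<^sup>2 + (norm q)\<^sup>2)" unfolding E_matrix_quadratic ny nq by simp
  finally show "lyapunov \<alpha> \<beta> \<phi> J y q \<le> c * ((norm y)\<^sup>2 + (norm q)\<^sup>2)" .
qed

end

section \<open>Differential inequalities\<close>

lemma has_vector_derivative_vec:
  fixes f :: "real \<Rightarrow> ('a::euclidean_space)^'n"
  assumes "\<And>i. ((\<lambda>r. f r $ i) has_vector_derivative f' $ i) (at s within S)"
  shows "(f has_vector_derivative f') (at s within S)"
  unfolding has_vector_derivative_def
proof (subst has_derivative_componentwise_within, rule ballI)
  fix b :: "'a^'n" assume "b \<in> Basis"
  then obtain i u where b: "b = axis i u" by (auto simp: Basis_vec_def)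
  have "((\<lambda>r. f r $ i \<bullet> u) has_derivative (\<lambda>h. (h *\<^sub>R f' $ i) \<bullet> u)) (at s within S)"
    using assms[of i] unfolding has_vector_derivative_def by (rule has_derivative_inner_left)
  then show "((\<lambda>r. f r \<bullet> b) has_derivative (\<lambda>h. (h *\<^sub>R f') \<bullet> b)) (at s within S)"
    by (simp add: b inner_axis)
qed

text \<open>The norm is smoothed to \<open>sqrt ((norm _)\<^sup>2 + \<eta>\<^sup>2)\<close> to be differentiable.\<close>

lemma backward_gronwall:
  fixes W :: "real \<Rightarrow> 'a::real_inner"
  assumes le: "s0 \<le> t" and K: "K > 0"
    and deriv: "\<And>s. s \<in> {s0..t} \<Longrightarrow> (W has_vector_derivative W' s) (at s within {s0..t})"
    and bound: "\<And>s. s \<in> {s0..t} \<Longrightarrow> norm (W' s) \<le> c + K * norm (W s - W t)"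
  shows "norm (W s0 - W t) \<le> c / K * (exp (K * (t - s0)) - 1)"
proof (rule field_le_epsilon)
  fix e :: real assume e: "e > 0"
  \<comment> \<open>At time t the smoothed norm equals \<eta>, and running back to s0 multiplies it
    by the exponential, so the smoothing costs exactly \<open>e\<close>.\<close>
  define \<eta> where "\<eta> = e / exp (K * (t - s0))"
  have \<eta>: "\<eta> > 0" using e by (simp add: \<eta>_def)
  define u where "u s = sqrt ((W s - W t) \<bullet> (W s - W t) + \<eta>\<^sup>2)" for s
  have pos: "(W s - W t) \<bullet> (W s - W t) + \<eta>\<^sup>2 > 0" for s
    using \<eta> by (simp add: add_nonneg_pos)
  have u_pos: "u s > 0" for s using pos by (simp add: u_def)
  have u_ge: "norm (W s - W t) \<le> u s" for s
    unfolding u_def norm_eq_sqrt_inner by simp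
  \<comment> \<open>The bound on W' gives u' \<ge> -(c + K u), which says that \<open>G\<close> is
    nondecreasing; comparing its values at s0 and t is the backward estimate.\<close>
  define G where "G s = (u s + c / K) * exp (K * s)" for s
  have du: "(u has_real_derivative ((W s - W t) \<bullet> W' s) / u s) (at s within {s0..t})"
    if s: "s \<in> {s0..t}" for s
  proof -
    have 1: "((\<lambda>s. W s - W t) has_vector_derivative W' s) (at s within {s0..t})"
      using has_vector_derivative_diff[OF deriv[OF s] has_vector_derivative_const] by simp
    have "((\<lambda>s. (W s - W t) \<bullet> (W s - W t) + \<eta>\<^sup>2) has_real_derivative 2 * ((W s - W t) \<bullet> W' s))
        (at s within {s0..t})"
      using has_vector_derivative_add[OF bounded_bilinear.has_vector_derivative[OF bounded_bilinear_inner 1 1]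
          has_vector_derivative_const[of "\<eta>\<^sup>2"]]
      by (simp add: has_real_derivative_iff_has_vector_derivative inner_commute)
    from DERIV_chain2[OF DERIV_real_sqrt[OF pos] this]
    show ?thesis by (simp add: u_def[abs_def] field_simps)
  qed
  have dG: "(G has_real_derivative (((W s - W t) \<bullet> W' s) / u s + K * u s + c) * exp (K * s)) (at s within {s0..t})"
    if s: "s \<in> {s0..t}" for s
    unfolding G_def using K by (auto intro!: derivative_eq_intros du[OF s] simp: field_simps)
  have nonneg: "0 \<le> (((W s - W t) \<bullet> W' s) / u s + K * u s + c) * exp (K * s)" if s: "s \<in> {s0..t}" for s
  proof -
    have "- ((W s - W t) \<bullet> W' s) \<le> norm (W s - W t) * norm (W' s)"
      using Cauchy_Schwarz_ineq2[of "W s - W t" "W' s"] by linarith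
    also have "\<dots> \<le> u s * (c + K * u s)"
    proof (intro mult_mono u_ge)
      show "norm (W' s) \<le> c + K * u s"
        using bound[OF s] mult_left_mono[OF u_ge[of s], of K] K by linarith
    qed (use u_pos[of s] in auto)
    finally have "- (((W s - W t) \<bullet> W' s) / u s) \<le> c + K * u s"
      using u_pos[of s] by (simp add: field_simps)
    then show ?thesis by simp
  qed
  have "G s0 \<le> G t"
  proof (rule DERIV_nonneg_imp_increasing_open[OF le])
    show "continuous_on {s0..t} G"
      using dG by (meson DERIV_continuous continuous_on_eq_continuous_within)
    fix s assume "s0 < s" "s < t"
    then show "\<exists>y. (G has_real_derivative y) (at s) \<and> 0 \<le> y"
      using dG[of s] nonneg[of s] by (auto simp: at_within_Icc_at)
  qed
  then have "u s0 + c / K \<le> (\<eta> + c / K) * exp (K * (t - s0))"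
    using \<eta> unfolding G_def u_def by (simp add: right_diff_distrib exp_diff field_simps)
  also have "\<dots> = e + c / K * exp (K * (t - s0))"
    by (simp add: \<eta>_def distrib_right)
  finally show "norm (W s0 - W t) \<le> c / K * (exp (K * (t - s0)) - 1) + e"
    using u_ge[of s0] by (simp add: right_diff_distrib)
qed

lemma exponential_decay:
  fixes f :: "real \<Rightarrow> real"
  assumes le: "s0 \<le> t"
    and deriv: "\<And>s. s \<in> {s0..t} \<Longrightarrow> (f has_real_derivative f' s) (at s within {s0..t})"
    and bound: "\<And>s. s \<in> {s0..t} \<Longrightarrow> f' s \<le> - r * f s"
  shows "f t \<le> f s0 * exp (- r * (t - s0))"
proof -
  define G where "G s = f s * exp (r * s)" for s
  have dG: "(G has_real_derivative (f' s + r * f s) * exp (r * s)) (at s within {s0..t})"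
    if s: "s \<in> {s0..t}" for s
    unfolding G_def by (auto intro!: derivative_eq_intros deriv[OF s] simp: field_simps)
  have "G t \<le> G s0"
  proof (rule DERIV_nonpos_imp_decreasing_open[OF le])
    show "continuous_on {s0..t} G"
      using dG by (meson DERIV_continuous continuous_on_eq_continuous_within)
    fix s assume "s0 < s" "s < t"
    then show "\<exists>y. (G has_real_derivative y) (at s) \<and> y \<le> 0"
      using dG[of s] bound[of s] by (auto simp: at_within_Icc_at mult_le_0_iff)
  qed
  then have "f t \<le> f s0 * exp (r * s0) / exp (r * t)"
    by (simp add: G_def pos_le_divide_eq)
  also have "\<dots> = f s0 * exp (- r * (t - s0))"
    by (simp add: exp_diff right_diff_distrib)
  finally show ?thesis .
qed

section \<open>Communication times\<close>

text \<open>\<open>GREATEST\<close> is meaningful only if a greatest time exists. It does: the times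
  satisfying the trigger inequality form a closed set by continuity of X, so the supremum is
  attained. The second claim starts strictly after s0 + \<tau>, because a failure at s0 + \<tau>
  itself makes that time the next communication.\<close>

lemma next_communication_bounds:
  assumes cont: "continuous_on {s0..} X" and \<tau>: "\<tau> \<ge> 0"
  shows next_communication_ge: "ereal (s0 + \<tau>) \<le> next_communication \<tau> \<kappa> s0 X"
    and next_communication_trigger: "s0 + \<tau> < s \<Longrightarrow> ereal s \<le> next_communication \<tau> \<kappa> s0 X
      \<Longrightarrow> (norm (disagreement (X s0 - X s)))\<^sup>2 \<le> \<kappa> * (norm (disagreement (X s)))\<^sup>2"
proof -
  define ok where "ok s \<longleftrightarrow> (norm (disagreement (X s0 - X s)))\<^sup>2 \<le> \<kappa> * (norm (disagreement (X s)))\<^sup>2" for s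
  let ?a = "s0 + \<tau>" and ?P = "\<lambda>t. s0 + \<tau> \<le> t \<and> (\<forall>s\<in>{s0 + \<tau>..t}. ok s)"
  have eq: "next_communication \<tau> \<kappa> s0 X = (if \<not> ok ?a then ereal ?a else if \<forall>s\<ge>?a. ok s then \<infinity>
      else ereal (GREATEST t. ?P t))"
    unfolding next_communication_def ok_def Let_def ..
  have great: "?P (GREATEST t. ?P t)" if a: "ok ?a" and nb: "\<not> (\<forall>s\<ge>?a. ok s)"
  proof -
    obtain b where b: "b \<ge> ?a" "\<not> ok b" using nb by blast
    let ?T = "{t. ?P t}"
    have Ta: "?a \<in> ?T" using a by auto
    have ub: "t \<le> b" if "?P t" for t using b that by force
    have bdd: "bdd_above ?T" using ub by (intro bdd_aboveI[of _ b]) auto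
    define u where "u = Sup ?T"
    have au: "?a \<le> u" unfolding u_def by (rule cSup_upper[OF Ta bdd])
    have below: "ok s" if "?a \<le> s" "s < u" for s
    proof -
      obtain t where "t \<in> ?T" "s < t" using \<open>s < u\<close> less_cSup_iff[OF _ bdd] Ta unfolding u_def by blast
      then show ?thesis using that by auto
    qed
    have "ok u"
    \<comment> \<open>For \<open>u = ?a\<close> the half-open interval is empty and its closure
      gives nothing; the assumption at \<open>?a\<close> covers this case.\<close>
    proof (cases "u = ?a")
      case False
      have contX: "continuous_on {?a..} X" using cont \<tau> by (rule_tac continuous_on_subset) auto
      have "linear (disagreement :: (real^'a)^'b \<Rightarrow> _)"
        using linear_act[of centering] by (simp add: disagreement_act[abs_def])
      then have lin: "bounded_linear (disagreement :: (real^'a)^'b \<Rightarrow> _)"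
        by (simp add: linear_conv_bounded_linear)
      have "closed {s \<in> {?a..}. (norm (disagreement (X s0 - X s)))\<^sup>2 - \<kappa> * (norm (disagreement (X s)))\<^sup>2 \<in> {..0}}"
        by (intro continuous_closed_preimage[unfolded vimage_def Int_def mem_Collect_eq, simplified]
            continuous_intros contX bounded_linear.continuous_on[OF lin] closed_atLeast)
      then have "closed {s \<in> {?a..}. ok s}" by (simp add: ok_def)
      moreover have "{?a..<u} \<subseteq> {s \<in> {?a..}. ok s}" using below by auto
      ultimately have "closure {?a..<u} \<subseteq> {s \<in> {?a..}. ok s}" by (rule closure_minimal[rotated])
      then show ?thesis using False au by auto
    qed (use a in simp)
    then have "?P u" using below au by (metis atLeastAtMost_iff order_le_less)
    moreover have "t \<le> u" if "?P t" for t
      unfolding u_def by (rule cSup_upper[OF _ bdd]) (use that in simp)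
    ultimately show ?thesis by (rule GreatestI2_order) blast+
  qed
  show "ereal ?a \<le> next_communication \<tau> \<kappa> s0 X"
  proof (cases "ok ?a \<and> \<not> (\<forall>s\<ge>?a. ok s)")
    case True
    then show ?thesis using conjunct1[OF great] by (simp only: eq not_True_eq_False if_False ereal_less_eq) simp
  qed (auto simp: eq)
  assume s: "s0 + \<tau> < s" "ereal s \<le> next_communication \<tau> \<kappa> s0 X"
  have a: "ok ?a"
  proof (rule ccontr)
    assume "\<not> ok ?a"
    then have "next_communication \<tau> \<kappa> s0 X = ereal ?a" by (simp add: eq)
    then show False using s by simp
  qed
  have "ok s"
  proof (cases "\<forall>s\<ge>?a. ok s")
    case False
    then have "next_communication \<tau> \<kappa> s0 X = ereal (GREATEST t. ?P t)" using a by (simp only: eq) simp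
    then have "s \<le> (GREATEST t. ?P t)" using s by simp
    then have "s \<in> {?a..(GREATEST t. ?P t)}" using less_imp_le[OF s(1)] by (simp only: atLeastAtMost_iff simp_thms)
    then show ?thesis by (rule bspec[OF conjunct2[OF great[OF a False]]])
  qed (use s in simp)
  then show "(norm (disagreement (X s0 - X s)))\<^sup>2 \<le> \<kappa> * (norm (disagreement (X s)))\<^sup>2"
    by (simp only: ok_def)
qed

section \<open>The dissipation estimates\<close>

text \<open>Two Young inequalities: one spends the share \<epsilon> of the consensus term on the
  error, the other spends \<gamma>/2 |q|^2. Here z, e, Q stand for the norms of \<Pi> x, the
  sampling error and q, while c = \<alpha> \<beta> \<phi> and a = \<alpha> (\<phi> + 1).\<close>

lemma mixed_terms_bound:
  fixes c lam2 lamN a \<epsilon> \<gamma> z e Q X1 X2 :: real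
  assumes "c > 0" "lam2 > 0" "\<epsilon> > 0" "\<gamma> > 0"
    and X1: "lam2 * z\<^sup>2 \<le> X1" and X2: "- (lamN * z * e) \<le> X2"
  shows "- c * (X1 + X2) + a * Q * e
    \<le> - c * lam2 * (1 - \<epsilon>) * z\<^sup>2 + \<gamma> / 2 * Q\<^sup>2 + (c * lamN\<^sup>2 / (4 * \<epsilon> * lam2) + a\<^sup>2 / (2 * \<gamma>)) * e\<^sup>2"
proof -
  have "0 \<le> (2 * \<epsilon> * lam2 * z - lamN * e)\<^sup>2 / (4 * \<epsilon> * lam2)" using assms by simp
  also have "\<dots> = \<epsilon> * lam2 * z\<^sup>2 - lamN * z * e + lamN\<^sup>2 / (4 * \<epsilon> * lam2) * e\<^sup>2"
    using assms by (simp add: power2_eq_square field_simps)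
  finally have "- (X1 + X2) \<le> - lam2 * (1 - \<epsilon>) * z\<^sup>2 + lamN\<^sup>2 / (4 * \<epsilon> * lam2) * e\<^sup>2"
    using X1 X2 by (simp add: algebra_simps)
  from mult_left_mono[OF this, of c] assms
  have 1: "- c * (X1 + X2) \<le> - c * lam2 * (1 - \<epsilon>) * z\<^sup>2 + c * lamN\<^sup>2 / (4 * \<epsilon> * lam2) * e\<^sup>2"
    by (simp add: algebra_simps)
  have "0 \<le> (\<gamma> * Q - a * e)\<^sup>2 / (2 * \<gamma>)" using assms by simp
  also have "\<dots> = \<gamma> / 2 * Q\<^sup>2 - a * Q * e + a\<^sup>2 / (2 * \<gamma>) * e\<^sup>2"
    using assms by (simp add: power2_eq_square field_simps)
  finally show ?thesis using 1 by (simp add: distrib_right)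
qed

text \<open>With \<gamma> = \<epsilon>/2 the error coefficient is D / (4 \<epsilon> lam2), where D
  is the denominator of \<open>\<zeta>\<^sup>2\<close>. The value of \<zeta> thus lets the error use
  the share 1 - \<epsilon> of |U|^2 / 2 and of \<delta>/2 z^2. The mean part Y^2 - z^2 is untouched
  by the error and keeps all of \<delta>/2.\<close>

lemma initial_phase_dissipation:
  fixes c lam2 lamN a \<epsilon> \<delta> \<rho> \<zeta> z e Y U Q X1 X2 :: real
  assumes pos: "c > 0" "lam2 > 0" "0 < \<epsilon>" "\<epsilon> < 1" "\<delta> > 0" "a > 0"
    and X1: "lam2 * z\<^sup>2 \<le> X1" and X2: "- (lamN * z * e) \<le> X2" and zY: "z\<^sup>2 \<le> Y\<^sup>2"
    and \<rho>: "\<rho> \<le> \<delta>" "\<rho> \<le> 2 * c * lam2 * (1 - \<epsilon>)\<^sup>2" "\<rho> \<le> \<epsilon> / 2"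
    and \<zeta>: "\<zeta>\<^sup>2 = 2 * \<epsilon> * (1 - \<epsilon>) * lam2 * min \<delta> 1 / (c * lamN\<^sup>2 + 4 * lam2 * a\<^sup>2)"
    and e: "e\<^sup>2 \<le> \<zeta>\<^sup>2 * (U\<^sup>2 + z\<^sup>2)"
  shows "- \<delta> / 2 * Y\<^sup>2 - 1/2 * U\<^sup>2 - 1/2 * Q\<^sup>2 - c * (X1 + X2) + a * Q * e \<le> - \<rho> / 2 * (Y\<^sup>2 + Q\<^sup>2)"
proof -
  define D where "D = c * lamN\<^sup>2 + 4 * lam2 * a\<^sup>2"
  have D: "D > 0" unfolding D_def using pos by (simp add: add_nonneg_pos)
  have "(c * lamN\<^sup>2 / (4 * \<epsilon> * lam2) + a\<^sup>2 / (2 * (\<epsilon> / 2))) * e\<^sup>2 = D / (4 * \<epsilon> * lam2) * e\<^sup>2"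
    unfolding D_def using pos by (simp add: field_simps)
  also have "\<dots> \<le> D / (4 * \<epsilon> * lam2) * (\<zeta>\<^sup>2 * (U\<^sup>2 + z\<^sup>2))"
    using e D pos by (intro mult_left_mono) auto
  also have "\<dots> = (1 - \<epsilon>) * min \<delta> 1 / 2 * (U\<^sup>2 + z\<^sup>2)"
    unfolding \<zeta> D_def[symmetric] using D pos by (simp add: field_simps)
  also have "\<dots> \<le> (1 - \<epsilon>) / 2 * U\<^sup>2 + (1 - \<epsilon>) * \<delta> / 2 * z\<^sup>2"
  proof -
    have "(1 - \<epsilon>) * min \<delta> 1 * U\<^sup>2 \<le> (1 - \<epsilon>) * U\<^sup>2"
      using pos by (intro mult_right_mono mult_left_le) auto
    moreover have "(1 - \<epsilon>) * min \<delta> 1 * z\<^sup>2 \<le> (1 - \<epsilon>) * \<delta> * z\<^sup>2"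
      using pos by (intro mult_right_mono mult_left_mono) auto
    ultimately show ?thesis by (simp add: field_simps)
  qed
  finally have e: "(c * lamN\<^sup>2 / (4 * \<epsilon> * lam2) + a\<^sup>2 / (2 * (\<epsilon> / 2))) * e\<^sup>2
    \<le> (1 - \<epsilon>) / 2 * U\<^sup>2 + (1 - \<epsilon>) * \<delta> / 2 * z\<^sup>2" .
  have mixed: "- c * (X1 + X2) + a * Q * e
    \<le> - c * lam2 * (1 - \<epsilon>) * z\<^sup>2 + (\<epsilon> / 2) / 2 * Q\<^sup>2 + (c * lamN\<^sup>2 / (4 * \<epsilon> * lam2) + a\<^sup>2 / (2 * (\<epsilon> / 2))) * e\<^sup>2"
    by (rule mixed_terms_bound) (use pos X1 X2 in auto)
  have Y: "\<rho> / 2 * (Y\<^sup>2 - z\<^sup>2) \<le> \<delta> / 2 * (Y\<^sup>2 - z\<^sup>2)" using \<rho> zY by (intro mult_right_mono) auto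
  have Q: "\<rho> / 2 * Q\<^sup>2 \<le> (1 / 2 - \<epsilon> / 4) * Q\<^sup>2" using \<rho> pos by (intro mult_right_mono) auto
  have U: "0 \<le> \<epsilon> / 2 * U\<^sup>2" using pos by simp
  have "(1 - \<epsilon>)\<^sup>2 \<le> 1 - \<epsilon>" using pos by (simp add: power2_eq_square mult_left_le)
  then have "c * lam2 * (1 - \<epsilon>)\<^sup>2 \<le> c * lam2 * (1 - \<epsilon>)" using pos by (intro mult_left_mono) auto
  then have "\<rho> / 2 \<le> c * lam2 * (1 - \<epsilon>) + \<epsilon> * \<delta> / 2" using \<rho>(2) mult_pos_pos[OF pos(3,5)] by linarith
  then have Z: "\<rho> / 2 * z\<^sup>2 \<le> (c * lam2 * (1 - \<epsilon>) + \<epsilon> * \<delta> / 2) * z\<^sup>2" by (rule mult_right_mono) simp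
  show ?thesis using mixed e Y Q U Z
    by (simp add: algebra_simps add_divide_distrib diff_divide_distrib)
qed

text \<open>Here \<gamma> = \<epsilon>, whence the factor 2 instead of 4 in the denominator. By the
  choice of \<kappa> the error uses up \<delta>/2 z^2 and the further share \<epsilon> of the
  remaining consensus term, which leaves c lam2 (1 - \<epsilon>)^2 z^2; |U|^2 is simply
  dropped.\<close>

lemma triggered_phase_dissipation:
  fixes c lam2 lamN a \<epsilon> \<delta> \<rho> \<kappa> z e Y U Q X1 X2 :: real
  assumes pos: "c > 0" "lam2 > 0" "0 < \<epsilon>" "\<epsilon> < 1" "\<delta> > 0" "a > 0"
    and X1: "lam2 * z\<^sup>2 \<le> X1" and X2: "- (lamN * z * e) \<le> X2" and zY: "z\<^sup>2 \<le> Y\<^sup>2"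
    and \<rho>: "\<rho> \<le> \<delta>" "\<rho> \<le> 2 * c * lam2 * (1 - \<epsilon>)\<^sup>2" "\<rho> \<le> 1 - \<epsilon>"
    and \<kappa>: "\<kappa> = 2 * ((\<epsilon> * \<delta> * lam2 + 2 * c * lam2\<^sup>2 * \<epsilon>\<^sup>2 * (1 - \<epsilon>)) / (c * lamN\<^sup>2 + 2 * lam2 * a\<^sup>2))"
    and e: "e\<^sup>2 \<le> \<kappa> * z\<^sup>2"
  shows "- \<delta> / 2 * Y\<^sup>2 - 1/2 * U\<^sup>2 - 1/2 * Q\<^sup>2 - c * (X1 + X2) + a * Q * e \<le> - \<rho> / 2 * (Y\<^sup>2 + Q\<^sup>2)"
proof -
  define D where "D = c * lamN\<^sup>2 + 2 * lam2 * a\<^sup>2"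
  have D: "D > 0" unfolding D_def using pos by (simp add: add_nonneg_pos)
  have "(c * lamN\<^sup>2 / (4 * \<epsilon> * lam2) + a\<^sup>2 / (2 * \<epsilon>)) * e\<^sup>2 = D / (4 * \<epsilon> * lam2) * e\<^sup>2"
    unfolding D_def using pos by (simp add: field_simps)
  also have "\<dots> \<le> D / (4 * \<epsilon> * lam2) * (\<kappa> * z\<^sup>2)"
    using e D pos by (intro mult_left_mono) auto
  also have "\<dots> = (\<delta> / 2 + c * lam2 * \<epsilon> * (1 - \<epsilon>)) * z\<^sup>2"
    unfolding \<kappa> D_def[symmetric] using D pos by (simp add: field_simps power2_eq_square)
  finally have e: "(c * lamN\<^sup>2 / (4 * \<epsilon> * lam2) + a\<^sup>2 / (2 * \<epsilon>)) * e\<^sup>2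
    \<le> (\<delta> / 2 + c * lam2 * \<epsilon> * (1 - \<epsilon>)) * z\<^sup>2" .
  have mixed: "- c * (X1 + X2) + a * Q * e
    \<le> - c * lam2 * (1 - \<epsilon>) * z\<^sup>2 + \<epsilon> / 2 * Q\<^sup>2 + (c * lamN\<^sup>2 / (4 * \<epsilon> * lam2) + a\<^sup>2 / (2 * \<epsilon>)) * e\<^sup>2"
    by (rule mixed_terms_bound) (use pos X1 X2 in auto)
  have Y: "\<rho> / 2 * (Y\<^sup>2 - z\<^sup>2) \<le> \<delta> / 2 * (Y\<^sup>2 - z\<^sup>2)" using \<rho> zY by (intro mult_right_mono) auto
  have Q: "\<rho> / 2 * Q\<^sup>2 \<le> (1 - \<epsilon>) / 2 * Q\<^sup>2" using \<rho> by (intro mult_right_mono) auto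
  have Z: "\<rho> / 2 * z\<^sup>2 \<le> c * lam2 * (1 - \<epsilon>)\<^sup>2 * z\<^sup>2" using \<rho> by (intro mult_right_mono) auto
  have "- \<delta> / 2 * Y\<^sup>2 - 1/2 * Q\<^sup>2 - c * (X1 + X2) + a * Q * e \<le> - \<rho> / 2 * (Y\<^sup>2 + Q\<^sup>2)"
    using mixed e Y Q Z by (simp add: algebra_simps power2_eq_square[of "1 - \<epsilon>"])
  moreover have "0 \<le> 1/2 * U\<^sup>2" by simp
  ultimately show ?thesis by linarith
qed

section \<open>The closed loop\<close>

locale event_triggered_network = reduction A R lam
  for A :: "real^'n^'n" and R :: "real^'m^'n" and lam :: "nat \<Rightarrow> real" +
  fixes g :: "'n \<Rightarrow> real^'d \<Rightarrow> real^'d" and xstar :: "real^'d"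
    and mmin Mmax \<alpha> \<beta> \<epsilon> \<delta> \<phi> \<zeta> \<tau> \<kappa> lamE :: real
  assumes g_mono: "\<And>i x z. mmin * (norm (z - x))\<^sup>2 \<le> (z - x) \<bullet> (g i z - g i x)"
    and g_lipschitz: "\<And>i x z. norm (g i z - g i x) \<le> Mmax * norm (z - x)"
    and xstar: "(\<Sum>i\<in>UNIV. g i xstar) = 0"
    and mmin_pos: "mmin > 0" and mmin_le_Mmax: "mmin \<le> Mmax"
    and params: "\<alpha> > 0" "\<beta> > 0" "0 < \<epsilon>" "\<epsilon> < 1" "\<delta> > 0"
    and phi: "\<phi> = 1 / (2 * mmin) * Mmax\<^sup>2 + 1 / (2 * mmin * \<alpha>\<^sup>2) * \<delta> - 1"
    and phi_pos: "\<phi> > 0"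
    and zeta_pos: "\<zeta> > 0"
    and zeta: "\<zeta>\<^sup>2 = 2 * \<epsilon> * (1 - \<epsilon>) * lam 2 * min \<delta> 1
                 / (\<alpha> * \<beta> * (lam CARD('n))\<^sup>2 * \<phi> + 4 * \<alpha>\<^sup>2 * lam 2 * (1 + \<phi>)\<^sup>2)"
    and tau: "\<tau> = 1 / (\<alpha> * Mmax + 1)
                 * ln (1 + (\<alpha> * Mmax + 1) * \<zeta>
                         / (\<alpha> * Mmax + 1 + \<beta> * lam CARD('n) * sqrt (1 + \<alpha>\<^sup>2) * (1 + \<zeta>)))"
    and kappa: "\<kappa> = 2 * ((\<epsilon> * \<delta> * lam 2 + 2 * \<phi> * \<alpha> * \<beta> * (lam 2)\<^sup>2 * \<epsilon>\<^sup>2 * (1 - \<epsilon>))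
                 / (\<alpha> * \<beta> * \<phi> * (lam CARD('n))\<^sup>2 + 2 * lam 2 * \<alpha>\<^sup>2 * (1 + \<phi>)\<^sup>2))"
    and lamE: "lamE = Max {c. eigenvalue
                 (E_matrix \<alpha> \<beta> \<phi> (laplacian A) R
                    :: real^('d + ('m \<times> 'd + 'm \<times> 'd))^('d + ('m \<times> 'd + 'm \<times> 'd))) c}"
begin

abbreviation L where "L \<equiv> act (laplacian A)"
abbreviation P where "P \<equiv> act (centering :: real^'n^'n)"

definition xs :: "(real^'d)^'n" where "xs = (\<chi> i. xstar)"
definition gs :: "(real^'d)^'n" where "gs = (\<chi> i. g i xstar)"
definition h :: "(real^'d)^'n \<Rightarrow> (real^'d)^'n" where "h x = (\<chi> i. g i (x $ i)) - gs"
text \<open>The equilibrium value of v is -\<alpha> gs: at the consensus state \<open>xs\<close> the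
  coupling vanishes and v must balance the gradients.\<close>

definition q :: "(real^'d)^'n \<Rightarrow> (real^'d)^'n" where "q v = v + \<alpha> *\<^sub>R gs"
definition U where "U x v = \<alpha> *\<^sub>R h x + q v"
text \<open>\<open>K\<close> is a Lipschitz constant of U in (y, q). \<open>B\<close> bounds the
  held input (-\<beta> L x0, \<alpha> \<beta> L x0) per unit of |\<Pi> x0|; the square root is the
  Euclidean norm of the pair.\<close>

definition K where "K = \<alpha> * Mmax + 1"
definition B where "B = \<beta> * lam CARD('n) * sqrt (1 + \<alpha>\<^sup>2)"

section \<open>Dwell time and trigger constants\<close>

lemma lamN_pos: "lam CARD('n) > 0"
  using lam2_pos second_le_last_eigenvalue[OF N G lam] by linarith

lemma Mmax_pos: "Mmax > 0" using mmin_pos mmin_le_Mmax by linarith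

lemma K_ge_1: "K \<ge> 1" using params Mmax_pos by (simp add: K_def)

lemma B_nonneg: "B \<ge> 0" using params lamN_pos by (simp add: B_def)

lemma exp_K_tau: "exp (K * \<tau>) - 1 = K * \<zeta> / (K + B * (1 + \<zeta>))"
proof -
  have den: "K + B * (1 + \<zeta>) > 0" using K_ge_1 B_nonneg zeta_pos by (simp add: add_pos_nonneg)
  have "K * \<tau> = ln (1 + K * \<zeta> / (K + B * (1 + \<zeta>)))"
    using K_ge_1 unfolding tau K_def[symmetric] B_def[symmetric] by simp
  moreover have "1 + K * \<zeta> / (K + B * (1 + \<zeta>)) > 0"
    using den K_ge_1 zeta_pos by (intro add_pos_nonneg) auto
  ultimately show ?thesis by simp
qed

lemma tau_pos: "\<tau> > 0"
proof -
  have "K * \<zeta> / (K + B * (1 + \<zeta>)) > 0"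
    using K_ge_1 B_nonneg zeta_pos by (intro divide_pos_pos add_pos_nonneg) auto
  then have "exp (K * \<tau>) > 1" using exp_K_tau by linarith
  then show ?thesis using K_ge_1 by (simp add: zero_less_mult_iff)
qed

lemma phi_eq: "2 * mmin * (\<alpha>\<^sup>2 * (\<phi> + 1)) = \<alpha>\<^sup>2 * Mmax\<^sup>2 + \<delta>"
  using mmin_pos params by (simp add: phi field_simps)

text \<open>Numerator and denominator are compared term by term. Squaring the formula for \<phi> and
  using (a + b)^2 \<ge> 4 a b together with mmin \<le> Mmax gives \<delta> \<le> \<alpha>^2 (1 +
  \<phi>)^2; the other pair needs 4 \<epsilon>^2 (1 - \<epsilon>) \<le> 1 and lam 2 \<le> lam
  N.\<close>

lemma kappa_lt_1: "\<kappa> < 1"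
proof -
  have "\<delta> \<le> \<alpha>\<^sup>2 * (1 + \<phi>)\<^sup>2"
  proof -
    have "\<delta> * (4 * mmin\<^sup>2) \<le> 4 * \<delta> * Mmax\<^sup>2"
      using params mmin_pos mmin_le_Mmax by (simp add: power_mono)
    then have "\<delta> * (4 * mmin\<^sup>2) * \<alpha>\<^sup>2 \<le> 4 * \<delta> * Mmax\<^sup>2 * \<alpha>\<^sup>2" by (rule mult_right_mono) simp
    also have "\<dots> \<le> (\<alpha>\<^sup>2 * Mmax\<^sup>2 + \<delta>)\<^sup>2"
      using zero_le_power2[of "\<alpha>\<^sup>2 * Mmax\<^sup>2 - \<delta>"] by (simp add: power2_diff power2_sum algebra_simps)
    also have "\<dots> = \<alpha>\<^sup>2 * (1 + \<phi>)\<^sup>2 * (4 * mmin\<^sup>2) * \<alpha>\<^sup>2"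
      unfolding phi_eq[symmetric] by (simp add: power2_eq_square add.commute)
    finally have "\<delta> * (4 * mmin\<^sup>2 * \<alpha>\<^sup>2) \<le> \<alpha>\<^sup>2 * (1 + \<phi>)\<^sup>2 * (4 * mmin\<^sup>2 * \<alpha>\<^sup>2)"
      by (simp only: mult.assoc)
    then show ?thesis using mmin_pos params by (simp add: mult.commute)
  qed
  moreover have "\<epsilon> * \<delta> < \<delta>" using params by simp
  ultimately have "\<epsilon> * \<delta> < \<alpha>\<^sup>2 * (1 + \<phi>)\<^sup>2" by linarith
  then have 1: "2 * \<epsilon> * \<delta> * lam 2 < 2 * lam 2 * \<alpha>\<^sup>2 * (1 + \<phi>)\<^sup>2"
    using lam2_pos by (simp add: mult.assoc[symmetric] mult.commute[of _ "lam 2"])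
  have e: "4 * (\<epsilon>\<^sup>2 * (1 - \<epsilon>)) \<le> 1"
  proof -
    have "4 * (\<epsilon> * (1 - \<epsilon>)) \<le> 1" using zero_le_power2[of "2 * \<epsilon> - 1"] by (simp add: power2_eq_square algebra_simps)
    moreover have "\<epsilon> * (4 * (\<epsilon> * (1 - \<epsilon>))) \<le> 1 * (4 * (\<epsilon> * (1 - \<epsilon>)))"
      using params by (intro mult_right_mono) auto
    ultimately show ?thesis by (simp add: power2_eq_square)
  qed
  have "(lam 2)\<^sup>2 * (4 * (\<epsilon>\<^sup>2 * (1 - \<epsilon>))) \<le> (lam CARD('n))\<^sup>2 * 1"
    using e params lam2_pos second_le_last_eigenvalue[OF N G lam] by (intro mult_mono power_mono) auto
  then have "\<alpha> * \<beta> * \<phi> * ((lam 2)\<^sup>2 * (4 * (\<epsilon>\<^sup>2 * (1 - \<epsilon>)))) \<le> \<alpha> * \<beta> * \<phi> * ((lam CARD('n))\<^sup>2 * 1)"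
    using params phi_pos by (intro mult_left_mono) auto
  with 1 have "2 * (\<epsilon> * \<delta> * lam 2 + 2 * \<phi> * \<alpha> * \<beta> * (lam 2)\<^sup>2 * \<epsilon>\<^sup>2 * (1 - \<epsilon>))
      < \<alpha> * \<beta> * \<phi> * (lam CARD('n))\<^sup>2 + 2 * lam 2 * \<alpha>\<^sup>2 * (1 + \<phi>)\<^sup>2"
    by (simp add: algebra_simps)
  moreover have "0 < \<alpha> * \<beta> * \<phi> * (lam CARD('n))\<^sup>2 + 2 * lam 2 * \<alpha>\<^sup>2 * (1 + \<phi>)\<^sup>2"
    using params phi_pos lam2_pos lamN_pos by (simp add: add_pos_nonneg)
  ultimately show ?thesis by (simp add: kappa)
qed

section \<open>Gradient increments and projections\<close>

lemma inner_h_ge: "mmin * (norm (x - xs))\<^sup>2 \<le> (x - xs) \<bullet> h x"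
proof -
  have "mmin * (norm (x - xs))\<^sup>2 = (\<Sum>i\<in>UNIV. mmin * (norm (x $ i - xstar))\<^sup>2)"
    unfolding power2_norm_eq_inner inner_vec_def[of "x - xs"] by (simp add: sum_distrib_left xs_def)
  also have "\<dots> \<le> (\<Sum>i\<in>UNIV. (x $ i - xstar) \<bullet> (g i (x $ i) - g i xstar))"
    by (intro sum_mono g_mono)
  also have "\<dots> = (x - xs) \<bullet> h x"
    unfolding inner_vec_def[of "x - xs"] by (simp add: xs_def h_def gs_def)
  finally show ?thesis .
qed

lemma norm_h_diff: "norm (h x - h x') \<le> Mmax * norm (x - x')"
proof -
  have "(norm (h x - h x'))\<^sup>2 = (\<Sum>i\<in>UNIV. (norm (g i (x $ i) - g i (x' $ i)))\<^sup>2)"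
    unfolding power2_norm_eq_inner inner_vec_def[of "h x - h x'"] by (simp add: h_def)
  also have "\<dots> \<le> (\<Sum>i\<in>UNIV. (Mmax * norm (x $ i - x' $ i))\<^sup>2)"
    by (intro sum_mono power_mono g_lipschitz) auto
  also have "\<dots> = (Mmax * norm (x - x'))\<^sup>2"
    unfolding power_mult_distrib power2_norm_eq_inner inner_vec_def[of "x - x'"]
    by (simp add: sum_distrib_left)
  finally show ?thesis by (rule power2_le_imp_le) (use Mmax_pos in simp)
qed

lemma norm_h: "norm (h x) \<le> Mmax * norm (x - xs)"
  using norm_h_diff[of x xs] by (simp add: h_def xs_def gs_def)

lemma Pi_const: "P xs = 0"
  by (rule state_eqI) (unfold slice_act vec_eq_iff centering_mult, simp add: slice_def xs_def)

lemma Pi_idem: "P (P x) = P x"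
  by (rule state_eqI) (simp add: slice_act centering_idem)

lemma inner_Pi: "x \<bullet> P y = P x \<bullet> y"
  by (simp add: inner_act transpose_centering)

lemma inner_L: "x \<bullet> L y = L x \<bullet> y"
  by (simp add: inner_act laplacian_symmetric[OF G])

lemma L_Pi: "L (P x) = L x"
  by (rule state_eqI) (simp add: slice_act laplacian_centering)

lemma Pi_L: "P (L x) = L x"
proof -
  have "y \<bullet> P (L x) = y \<bullet> L x" for y by (simp add: inner_Pi inner_L L_Pi)
  then show ?thesis using vector_eq_ldot by blast
qed

lemma norm_Pi: "norm (P x) \<le> norm x"
proof -
  have "(norm (P x))\<^sup>2 = x \<bullet> P x"
    by (simp add: power2_norm_eq_inner inner_Pi Pi_idem)
  also have "\<dots> \<le> norm x * norm (P x)" by (rule norm_cauchy_schwarz)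
  finally have "norm (P x) * norm (P x) \<le> norm x * norm (P x)" by (simp add: power2_eq_square)
  then show ?thesis by (cases "norm (P x) = 0") (auto simp: mult_le_cancel_right)
qed

lemma Pi_eq: "(\<Sum>i\<in>UNIV. x $ i) = 0 \<Longrightarrow> P x = x"
  by (rule state_eqI) (simp add: slice_act vec_eq_iff centering_mult act_sum_one)

section \<open>Derivative of the Lyapunov function\<close>

definition lyapunov_rate where
  "lyapunov_rate x0 x v =
     - (\<alpha>\<^sup>2 * (\<phi> + 1) * ((x - xs) \<bullet> h x)) - \<alpha> * (q v \<bullet> h x) - (norm (q v))\<^sup>2
     - \<alpha> * \<beta> * \<phi> * (P x \<bullet> L (P x) + P x \<bullet> L (P (x0 - x))) + \<alpha> * (\<phi> + 1) * (q v \<bullet> P (x0 - x))"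

text \<open>The terms q \<bullet> L x0 cancel, y \<bullet> L x0 keeps the coefficient -\<alpha>
  \<beta> \<phi>, and q \<bullet> y cancels against the \<open>J\<close> term, since J q' = \<alpha>
  \<beta> \<Pi> x0 and q has zero mean.\<close>

lemma lyapunov_rate_eq:
  fixes x0 x v :: "(real^'d)^'n"
  assumes qv: "P (q v) = q v"
  defines "y \<equiv> x - xs" and "y' \<equiv> - U x v - \<beta> *\<^sub>R L x0" and "q' \<equiv> (\<alpha> * \<beta>) *\<^sub>R L x0"
  shows "\<alpha> * (\<phi> + 1) * (y \<bullet> y') + (y' \<bullet> q v + y \<bullet> q') + 1 / \<alpha> * (q v \<bullet> q')
      + (\<phi> + 1) / \<beta> * (q v \<bullet> act J q') = lyapunov_rate x0 x v"
proof -
  note lin = linear_diff[OF linear_act] linear_cmul[OF linear_act]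
  have Py: "P y = P x" by (simp add: y_def lin Pi_const)
  have yL: "y \<bullet> L x0 = P x \<bullet> L (P x) + P x \<bullet> L (P (x0 - x))"
    using inner_L[of y] inner_L[of "P x"] L_Pi[of y] L_Pi[of x] by (simp add: Py L_Pi lin inner_diff_right)
  have qx: "q v \<bullet> P x0 = q v \<bullet> y + q v \<bullet> P (x0 - x)"
    using inner_Pi[of "q v" y] by (simp add: qv Py lin inner_diff_right)
  have J: "act J q' = (\<alpha> * \<beta>) *\<^sub>R P x0" by (simp add: q'_def lin J_laplacian)
  have 1: "\<alpha> * (\<phi> + 1) * (y \<bullet> y') = - (\<alpha>\<^sup>2 * (\<phi> + 1) * (y \<bullet> h x)) - \<alpha> * (\<phi> + 1) * (q v \<bullet> y)
      - \<alpha> * \<beta> * (\<phi> + 1) * (y \<bullet> L x0)"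
    by (simp add: y'_def U_def inner_diff_right inner_add_right power2_eq_square algebra_simps inner_commute[of y "q v"])
  have 2: "y' \<bullet> q v = - (\<alpha> * (q v \<bullet> h x)) - (norm (q v))\<^sup>2 - \<beta> * (q v \<bullet> L x0)"
    by (simp add: y'_def U_def inner_diff_left inner_add_left power2_norm_eq_inner
        inner_commute[of "h x" "q v"] inner_commute[of "L x0" "q v"])
  have 3: "y \<bullet> q' = \<alpha> * \<beta> * (y \<bullet> L x0)" "1 / \<alpha> * (q v \<bullet> q') = \<beta> * (q v \<bullet> L x0)"
    using params by (simp_all add: q'_def)
  have 4: "(\<phi> + 1) / \<beta> * (q v \<bullet> act J q') = \<alpha> * (\<phi> + 1) * (q v \<bullet> y) + \<alpha> * (\<phi> + 1) * (q v \<bullet> P (x0 - x))"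
    using params unfolding J by (simp add: qx field_simps)
  show ?thesis
    unfolding 1 2 3 4 yL lyapunov_rate_def y_def[symmetric] by (simp add: algebra_simps)
qed

lemma lyapunov_rate_le:
  fixes x0 x v :: "(real^'d)^'n"
  defines "e \<equiv> P (x0 - x)"
  shows "lyapunov_rate x0 x v \<le> - \<delta> / 2 * (norm (x - xs))\<^sup>2 - 1/2 * (norm (U x v))\<^sup>2 - 1/2 * (norm (q v))\<^sup>2
      - \<alpha> * \<beta> * \<phi> * (P x \<bullet> L (P x) + P x \<bullet> L e) + \<alpha> * (\<phi> + 1) * norm (q v) * norm e"
proof -
  have "(\<alpha>\<^sup>2 * (norm (h x))\<^sup>2 + \<delta> * (norm (x - xs))\<^sup>2) / 2 \<le> (\<alpha>\<^sup>2 * Mmax\<^sup>2 + \<delta>) / 2 * (norm (x - xs))\<^sup>2"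
  proof -
    have "(norm (h x))\<^sup>2 \<le> Mmax\<^sup>2 * (norm (x - xs))\<^sup>2"
      using power_mono[OF norm_h[of x], of 2] by (simp add: power_mult_distrib)
    then have "\<alpha>\<^sup>2 * (norm (h x))\<^sup>2 \<le> \<alpha>\<^sup>2 * (Mmax\<^sup>2 * (norm (x - xs))\<^sup>2)" by (rule mult_left_mono) simp
    then show ?thesis by (simp add: algebra_simps)
  qed
  also have "\<dots> = \<alpha>\<^sup>2 * (\<phi> + 1) * (mmin * (norm (x - xs))\<^sup>2)" unfolding phi_eq[symmetric] by simp
  also have "\<dots> \<le> \<alpha>\<^sup>2 * (\<phi> + 1) * ((x - xs) \<bullet> h x)"
    using phi_pos by (intro mult_left_mono inner_h_ge) auto
  finally have "(\<alpha>\<^sup>2 * (norm (h x))\<^sup>2 + \<delta> * (norm (x - xs))\<^sup>2) / 2 \<le> \<alpha>\<^sup>2 * (\<phi> + 1) * ((x - xs) \<bullet> h x)" .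
  moreover have "(norm (U x v))\<^sup>2 = \<alpha>\<^sup>2 * (norm (h x))\<^sup>2 + 2 * (\<alpha> * (q v \<bullet> h x)) + (norm (q v))\<^sup>2"
    unfolding power2_norm_eq_inner U_def
    by (simp add: inner_add_left inner_add_right inner_commute[of "h x" "q v"] power2_eq_square algebra_simps)
  moreover have "\<alpha> * (\<phi> + 1) * (q v \<bullet> e) \<le> \<alpha> * (\<phi> + 1) * (norm (q v) * norm e)"
    using params phi_pos by (intro mult_left_mono norm_cauchy_schwarz) auto
  ultimately show ?thesis
    unfolding lyapunov_rate_def e_def[symmetric] by (simp add: add_divide_distrib algebra_simps)
qed

definition \<rho> where "\<rho> = Min {\<delta>, 2 * \<phi> * \<alpha> * \<beta> * lam 2 * (1 - \<epsilon>)\<^sup>2, 1 - \<epsilon>, (1/2) * \<epsilon>}"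

lemma rho_bounds:
  "\<rho> > 0" "\<rho> \<le> \<delta>" "\<rho> \<le> 2 * (\<alpha> * \<beta> * \<phi>) * lam 2 * (1 - \<epsilon>)\<^sup>2" "\<rho> \<le> 1 - \<epsilon>" "\<rho> \<le> \<epsilon> / 2"
proof -
  let ?S = "{\<delta>, 2 * \<phi> * \<alpha> * \<beta> * lam 2 * (1 - \<epsilon>)\<^sup>2, 1 - \<epsilon>, (1/2) * \<epsilon>}"
  show "\<rho> > 0" unfolding \<rho>_def using params phi_pos lam2_pos by simp
  have le: "\<rho> \<le> c" if "c \<in> ?S" for c unfolding \<rho>_def by (rule Min_le) (use that in auto)
  show "\<rho> \<le> \<delta>" "\<rho> \<le> 1 - \<epsilon>" by (rule le; simp)+
  show "\<rho> \<le> \<epsilon> / 2" using le[of "(1/2) * \<epsilon>"] by simp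
  show "\<rho> \<le> 2 * (\<alpha> * \<beta> * \<phi>) * lam 2 * (1 - \<epsilon>)\<^sup>2"
    using le[of "2 * \<phi> * \<alpha> * \<beta> * lam 2 * (1 - \<epsilon>)\<^sup>2"] by (simp add: mult_ac)
qed

lemma lyapunov_rate_decay:
  fixes x0 x v :: "(real^'d)^'n"
  defines "e \<equiv> P (x0 - x)"
  assumes err: "(norm e)\<^sup>2 \<le> \<zeta>\<^sup>2 * ((norm (U x v))\<^sup>2 + (norm (P x))\<^sup>2) \<or> (norm e)\<^sup>2 \<le> \<kappa> * (norm (P x))\<^sup>2"
  shows "lyapunov_rate x0 x v \<le> - \<rho> / 2 * ((norm (x - xs))\<^sup>2 + (norm (q v))\<^sup>2)"
proof -
  let ?z = "norm (P x)"
  have X1: "lam 2 * ?z\<^sup>2 \<le> P x \<bullet> L (P x)" by (rule act_laplacian_bounds(1)[OF N G lam])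
  have "- (P x \<bullet> L e) \<le> norm (P x) * norm (L e)"
    using Cauchy_Schwarz_ineq2[of "P x" "L e"] by linarith
  also have "\<dots> \<le> ?z * (lam CARD('n) * norm e)"
    by (intro mult_left_mono act_laplacian_bounds(2)[OF N G lam]) simp
  finally have X2: "- (lam CARD('n) * ?z * norm e) \<le> P x \<bullet> L e" by (simp add: mult_ac)
  have "P (x - xs) = P x" by (simp add: linear_diff[OF linear_act] Pi_const)
  then have zY: "?z\<^sup>2 \<le> (norm (x - xs))\<^sup>2" using norm_Pi[of "x - xs"] by (intro power_mono) auto
  have pos: "\<alpha> * \<beta> * \<phi> > 0" "\<alpha> * (\<phi> + 1) > 0" using params phi_pos by simp_all
  have zeta': "\<zeta>\<^sup>2 = 2 * \<epsilon> * (1 - \<epsilon>) * lam 2 * min \<delta> 1 / (\<alpha> * \<beta> * \<phi> * (lam CARD('n))\<^sup>2 + 4 * lam 2 * (\<alpha> * (\<phi> + 1))\<^sup>2)"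
    unfolding zeta by (simp add: power_mult_distrib mult_ac add.commute)
  have kappa': "\<kappa> = 2 * ((\<epsilon> * \<delta> * lam 2 + 2 * (\<alpha> * \<beta> * \<phi>) * (lam 2)\<^sup>2 * \<epsilon>\<^sup>2 * (1 - \<epsilon>))
      / (\<alpha> * \<beta> * \<phi> * (lam CARD('n))\<^sup>2 + 2 * lam 2 * (\<alpha> * (\<phi> + 1))\<^sup>2))"
    unfolding kappa by (simp add: power_mult_distrib mult_ac add.commute)
  note lyapunov_rate_le[of x0 x v, folded e_def]
  also have "- \<delta> / 2 * (norm (x - xs))\<^sup>2 - 1/2 * (norm (U x v))\<^sup>2 - 1/2 * (norm (q v))\<^sup>2
      - \<alpha> * \<beta> * \<phi> * (P x \<bullet> L (P x) + P x \<bullet> L e) + \<alpha> * (\<phi> + 1) * norm (q v) * norm e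
    \<le> - \<rho> / 2 * ((norm (x - xs))\<^sup>2 + (norm (q v))\<^sup>2)" (is ?bound)
    using err
  proof
    assume "(norm e)\<^sup>2 \<le> \<zeta>\<^sup>2 * ((norm (U x v))\<^sup>2 + (norm (P x))\<^sup>2)"
    show ?bound
      by (rule initial_phase_dissipation) (fact pos lam2_pos params X1 X2 zY rho_bounds zeta' | fact)+
  next
    assume "(norm e)\<^sup>2 \<le> \<kappa> * (norm (P x))\<^sup>2"
    show ?bound
      by (rule triggered_phase_dissipation) (fact pos lam2_pos params X1 X2 zY rho_bounds kappa' | fact)+
  qed
  finally show ?thesis .
qed

abbreviation W where "W x v \<equiv> lyapunov \<alpha> \<beta> \<phi> J (x - xs) (q v)"

lemma lamE_pos: "lamE > 0"
proof -
  have "0 < \<alpha> * (\<phi> + 1) / 2" using params phi_pos by simp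
  also have "\<dots> \<le> lamE" unfolding lamE by (rule Max_eigenvalue_E_ge)
  finally show ?thesis .
qed

section \<open>One interval with a held state\<close>

context
  fixes s0 :: real and x0 v0 :: "(real^'d)^'n" and X V :: "real \<Rightarrow> (real^'d)^'n"
  assumes held: "held_trajectory A \<alpha> \<beta> g s0 x0 v0 X V"
begin

lemma held_initial: "X s0 = x0" "V s0 = v0"
  using held by (auto simp: held_trajectory_def)

lemma held_components:
  assumes "s \<ge> s0"
  shows "((\<lambda>r. V r $ i) has_vector_derivative
      (\<alpha> * \<beta>) *\<^sub>R (\<Sum>j\<in>UNIV. A $ i $ j *\<^sub>R (x0 $ i - x0 $ j))) (at s within {s0..})"
    and "((\<lambda>r. X r $ i) has_vector_derivative
      - (\<alpha> *\<^sub>R g i (X s $ i)) - \<beta> *\<^sub>R (\<Sum>j\<in>UNIV. A $ i $ j *\<^sub>R (x0 $ i - x0 $ j)) - V s $ i)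
      (at s within {s0..})"
  using held assms unfolding held_trajectory_def by blast+

lemma held_V: "s \<ge> s0 \<Longrightarrow> (V has_vector_derivative (\<alpha> * \<beta>) *\<^sub>R L x0) (at s within {s0..})"
  by (rule has_vector_derivative_vec) (simp only: vector_scaleR_component act_laplacian held_components)

lemma held_X:
  assumes "s \<ge> s0"
  shows "(X has_vector_derivative - U (X s) (V s) - \<beta> *\<^sub>R L x0) (at s within {s0..})"
proof (rule has_vector_derivative_vec)
  fix i
  have "(- U (X s) (V s) - \<beta> *\<^sub>R L x0) $ i
    = - (\<alpha> *\<^sub>R g i (X s $ i)) - \<beta> *\<^sub>R (\<Sum>j\<in>UNIV. A $ i $ j *\<^sub>R (x0 $ i - x0 $ j)) - V s $ i"
    by (simp add: U_def h_def q_def act_laplacian scaleR_diff_right)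
  then show "((\<lambda>r. X r $ i) has_vector_derivative (- U (X s) (V s) - \<beta> *\<^sub>R L x0) $ i) (at s within {s0..})"
    using held_components(2)[OF assms, of i] by (simp only:)
qed

lemma held_q: "s \<ge> s0 \<Longrightarrow> ((\<lambda>s. q (V s)) has_vector_derivative (\<alpha> * \<beta>) *\<^sub>R L x0) (at s within {s0..})"
  using has_vector_derivative_add[OF held_V has_vector_derivative_const[of "\<alpha> *\<^sub>R gs"]] by (simp add: q_def)

lemma held_y: "s \<ge> s0 \<Longrightarrow> ((\<lambda>s. X s - xs) has_vector_derivative - U (X s) (V s) - \<beta> *\<^sub>R L x0) (at s within {s0..})"
  using has_vector_derivative_diff[OF held_X has_vector_derivative_const[of xs]] by simp

text \<open>q' lies in the range of L, which the projection fixes, so q - P q is conserved.\<close>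

lemma q_zero_sum:
  assumes "P (q v0) = q v0" "s \<ge> s0"
  shows "P (q (V s)) = q (V s)"
proof -
  have lin: "bounded_linear P" using linear_act by (simp add: linear_conv_bounded_linear)
  have "((\<lambda>s. q (V s) - P (q (V s))) has_derivative (\<lambda>_. 0)) (at r within {s0..})" if "r \<in> {s0..}" for r
    using has_vector_derivative_diff[OF held_q bounded_linear.has_vector_derivative[OF lin held_q], of r] that
    by (simp add: linear_cmul[OF linear_act] Pi_L has_vector_derivative_def)
  then obtain c where c: "\<And>r. r \<in> {s0..} \<Longrightarrow> q (V r) - P (q (V r)) = c"
    using has_derivative_zero_constant[of "{s0..}" "\<lambda>s. q (V s) - P (q (V s))"] by auto
  then show ?thesis using c[of s0] c[of s] assms held_initial by simp
qed

lemma lyapunov_derivative: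
  assumes "P (q v0) = q v0" "s \<ge> s0"
  shows "((\<lambda>s. W (X s) (V s)) has_real_derivative lyapunov_rate x0 (X s) (V s)) (at s within {s0..})"
proof -
  note y = held_y[OF assms(2)] and qd = held_q[OF assms(2)]
  note inner = bounded_bilinear.has_vector_derivative[OF bounded_bilinear_inner]
  have lin: "bounded_linear (act J :: (real^'d)^'n \<Rightarrow> _)" using linear_act by (simp add: linear_conv_bounded_linear)
  note Jq = bounded_linear.has_vector_derivative[OF lin qd]
  note d = inner[OF y y] inner[OF y qd] inner[OF qd qd] inner[OF qd Jq]
  let ?y = "X s - xs" and ?y' = "- U (X s) (V s) - \<beta> *\<^sub>R L x0" and ?q = "q (V s)" and ?q' = "(\<alpha> * \<beta>) *\<^sub>R L x0"
  have "((\<lambda>s. W (X s) (V s)) has_real_derivative 1/2 * (\<alpha> * (\<phi> + 1) * (?y \<bullet> ?y' + ?y' \<bullet> ?y) + 2 * (?y \<bullet> ?q' + ?y' \<bullet> ?q)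
      + 1 / \<alpha> * (?q \<bullet> ?q' + ?q' \<bullet> ?q) + (\<phi> + 1) / \<beta> * (?q \<bullet> act J ?q' + ?q' \<bullet> act J ?q))) (at s within {s0..})"
    unfolding lyapunov_def power2_norm_eq_inner
    by (intro DERIV_cmult DERIV_add d[folded has_real_derivative_iff_has_vector_derivative])
  moreover have "?y' \<bullet> ?y = ?y \<bullet> ?y'" "?q' \<bullet> ?q = ?q \<bullet> ?q'" by (rule inner_commute)+
  moreover have "?q' \<bullet> act J ?q = ?q \<bullet> act J ?q'"
    by (simp only: inner_act[of ?q'] transpose_J inner_commute[of ?q])
  moreover have "1/2 * (a * (y1 + y1) + 2 * (y2 + y3) + b * (y4 + y4) + c * (y5 + y5))
      = a * y1 + (y3 + y2) + b * y4 + c * y5" for a b c y1 y2 y3 y4 y5 :: real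
    by (simp add: algebra_simps)
  ultimately show ?thesis
    by (simp only: lyapunov_rate_eq[OF q_zero_sum[OF assms], symmetric])
qed

text \<open>The increment of \<open>(x - xs, q)\<close> is compared with the field at the final time \<open>t\<close>. That way the
  gradient enters the error only through \<open>U\<close>, which is dissipated.\<close>

lemma held_error:
  assumes t: "s0 \<le> t" "t \<le> s0 + \<tau>"
  shows "(norm (P (x0 - X t)))\<^sup>2 \<le> \<zeta>\<^sup>2 * ((norm (U (X t) (V t)))\<^sup>2 + (norm (P (X t)))\<^sup>2)"
proof -
  define F where "F s = (- U (X s) (V s) - \<beta> *\<^sub>R L x0, (\<alpha> * \<beta>) *\<^sub>R L x0)" for s
  define Z where "Z s = (X s - xs, q (V s))" for s
  define e u z where "e = norm (P (x0 - X t))" and "u = norm (U (X t) (V t))" and "z = norm (P (X t))"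
  \<comment> \<open>A bound for the field at the final time t; x0 is replaced by \<open>X t\<close>
    plus the error, so the unknown \<open>e\<close> occurs on both sides of the final
    estimate.\<close>
  define c where "c = u + B * (z + e)"
  have c: "c \<ge> 0" using B_nonneg by (simp add: c_def e_def u_def z_def)
  have Px0: "P x0 = P (X t) + P (x0 - X t)" by (simp add: linear_diff[OF linear_act])
  have Zd: "Z s - Z r = (X s - X r, q (V s) - q (V r))" for s r by (simp add: Z_def)
  have nX: "norm (X s - X r) \<le> norm (Z s - Z r)" for s r unfolding Zd by (rule norm_fst_le)
  have nq: "norm (q (V s) - q (V r)) \<le> norm (Z s - Z r)" for s r unfolding Zd by (rule norm_snd_le)
  have dZ: "(Z has_vector_derivative F s) (at s within {s0..t})" if "s \<in> {s0..t}" for s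
    unfolding Z_def F_def
    by (rule has_vector_derivative_Pair; rule has_vector_derivative_within_subset[of _ _ _ "{s0..}"])
      (use held_y held_q that in auto)
  have Ft: "norm (F t) \<le> c"
  proof -
    have "norm (F t) \<le> norm (- U (X t) (V t), 0 :: (real^'d)^'n) + norm (- \<beta> *\<^sub>R L x0, (\<alpha> * \<beta>) *\<^sub>R L x0)"
      using norm_triangle_ineq[of "(- U (X t) (V t), 0 :: (real^'d)^'n)" "(- \<beta> *\<^sub>R L x0, (\<alpha> * \<beta>) *\<^sub>R L x0)"]
      by (simp add: F_def)
    also have "norm (- U (X t) (V t), 0 :: (real^'d)^'n) = u" by (simp add: norm_Pair u_def)
    also have "norm (- \<beta> *\<^sub>R L x0, (\<alpha> * \<beta>) *\<^sub>R L x0) = \<beta> * sqrt (1 + \<alpha>\<^sup>2) * norm (L x0)"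
    proof -
      have "norm (- \<beta> *\<^sub>R L x0, (\<alpha> * \<beta>) *\<^sub>R L x0) = sqrt ((\<beta> * norm (L x0))\<^sup>2 * (1 + \<alpha>\<^sup>2))"
        by (simp add: norm_Pair power_mult_distrib algebra_simps)
      then show ?thesis using params by (simp add: real_sqrt_mult)
    qed
    finally have "norm (F t) \<le> u + \<beta> * sqrt (1 + \<alpha>\<^sup>2) * norm (L x0)" .
    also have "\<dots> \<le> u + \<beta> * sqrt (1 + \<alpha>\<^sup>2) * (lam CARD('n) * (z + e))"
    proof (intro add_left_mono mult_left_mono)
      have "norm (L x0) = norm (L (P x0))" by (simp add: L_Pi)
      also have "\<dots> \<le> lam CARD('n) * norm (P x0)" by (rule act_laplacian_bounds(2)[OF N G lam])
      also have "\<dots> \<le> lam CARD('n) * (z + e)"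
        unfolding Px0 z_def e_def using lamN_pos by (intro mult_left_mono norm_triangle_ineq) simp
      finally show "norm (L x0) \<le> lam CARD('n) * (z + e)" .
    qed (use params in simp)
    also have "\<dots> = c" by (simp add: c_def B_def mult_ac)
    finally show ?thesis .
  qed
  have bound: "norm (F s) \<le> c + K * norm (Z s - Z t)" for s
  proof -
    have "U (X t) (V t) - U (X s) (V s) = - (\<alpha> *\<^sub>R (h (X s) - h (X t)) + (q (V s) - q (V t)))"
      by (simp add: U_def algebra_simps)
    moreover have "F s - F t = (U (X t) (V t) - U (X s) (V s), 0)" by (simp add: F_def)
    ultimately have "norm (F s - F t) = norm (\<alpha> *\<^sub>R (h (X s) - h (X t)) + (q (V s) - q (V t)))"
      by (simp only: norm_Pair norm_minus_cancel) simp
    also have "\<dots> \<le> norm (\<alpha> *\<^sub>R (h (X s) - h (X t))) + norm (q (V s) - q (V t))"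
      by (rule norm_triangle_ineq)
    finally have "norm (F s - F t) \<le> norm (\<alpha> *\<^sub>R (h (X s) - h (X t))) + norm (q (V s) - q (V t))" .
    moreover have "norm (\<alpha> *\<^sub>R (h (X s) - h (X t))) \<le> \<alpha> * (Mmax * norm (X s - X t))"
      using norm_h_diff[of "X s" "X t"] params by simp
    moreover have "\<alpha> * (Mmax * norm (X s - X t)) \<le> \<alpha> * (Mmax * norm (Z s - Z t))"
      by (intro mult_left_mono nX) (use params Mmax_pos in auto)
    moreover have "norm (q (V s) - q (V t)) \<le> norm (Z s - Z t)" by (rule nq)
    moreover have "K * norm (Z s - Z t) = \<alpha> * (Mmax * norm (Z s - Z t)) + norm (Z s - Z t)"
      by (simp add: K_def algebra_simps)
    ultimately have "norm (F s - F t) \<le> K * norm (Z s - Z t)" by linarith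
    then show ?thesis using Ft norm_triangle_ineq2[of "F s" "F t"] by linarith
  qed
  have "norm (Z s0 - Z t) \<le> c / K * (exp (K * (t - s0)) - 1)"
    by (rule backward_gronwall[OF t(1) _ dZ bound]) (use K_ge_1 in auto)
  also have "\<dots> \<le> c / K * (exp (K * \<tau>) - 1)"
    using c K_ge_1 t by (intro mult_left_mono) (auto simp: mult_le_cancel_left)
  also have "\<dots> = c * \<zeta> / (K + B * (1 + \<zeta>))" unfolding exp_K_tau using K_ge_1 by simp
  finally have "norm (Z s0 - Z t) \<le> c * \<zeta> / (K + B * (1 + \<zeta>))" .
  moreover have "e \<le> norm (Z s0 - Z t)"
    using order_trans[OF norm_Pi nX[of s0 t]] by (simp only: e_def held_initial)
  ultimately have "e \<le> c * \<zeta> / (K + B * (1 + \<zeta>))" by linarith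
  moreover have "K + B * (1 + \<zeta>) > 0" using K_ge_1 B_nonneg zeta_pos by (simp add: add_pos_nonneg)
  ultimately have "e * (K + B * (1 + \<zeta>)) \<le> c * \<zeta>" by (simp add: pos_le_divide_eq)
  \<comment> \<open>The summand B \<zeta> e cancels on both sides. This is why \<tau> contains the
    factor 1 + \<zeta>.\<close>
  then have "e * (K + B) \<le> \<zeta> * (u + B * z)" by (simp add: c_def algebra_simps)
  also have "\<dots> \<le> \<zeta> * (sqrt (u\<^sup>2 + z\<^sup>2) * (K + B))"
  proof (rule mult_left_mono)
    have "u \<le> sqrt (u\<^sup>2 + z\<^sup>2) * K"
      using mult_mono[OF real_sqrt_sum_squares_ge1[of u z] K_ge_1] by simp
    moreover have "B * z \<le> B * sqrt (u\<^sup>2 + z\<^sup>2)"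
      using B_nonneg by (intro mult_left_mono real_sqrt_sum_squares_ge2)
    ultimately show "u + B * z \<le> sqrt (u\<^sup>2 + z\<^sup>2) * (K + B)" by (simp add: algebra_simps)
  qed (use zeta_pos in simp)
  finally have "e \<le> \<zeta> * sqrt (u\<^sup>2 + z\<^sup>2)" using K_ge_1 B_nonneg by (simp add: mult.assoc[symmetric] mult_le_cancel_right)
  then have "e\<^sup>2 \<le> (\<zeta> * sqrt (u\<^sup>2 + z\<^sup>2))\<^sup>2" by (rule power_mono) (simp add: e_def)
  then show ?thesis by (simp add: power_mult_distrib e_def u_def z_def)
qed

lemma held_decay:
  assumes q0: "P (q v0) = q v0" and t: "s0 \<le> t" "ereal t \<le> next_communication \<tau> \<kappa> s0 X"
  shows "W (X t) (V t) \<le> W x0 v0 * exp (- (\<rho> / (2 * lamE)) * (t - s0))"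
proof -
  have contX: "continuous_on {s0..} X"
    using held_X by (meson atLeast_iff continuous_on_eq_continuous_within has_vector_derivative_continuous)
  have "W (X t) (V t) \<le> W (X s0) (V s0) * exp (- (\<rho> / (2 * lamE)) * (t - s0))"
  proof (rule exponential_decay[OF t(1)])
    fix s assume s: "s \<in> {s0..t}"
    show "((\<lambda>s. W (X s) (V s)) has_real_derivative lyapunov_rate x0 (X s) (V s)) (at s within {s0..t})"
      by (rule DERIV_subset[OF lyapunov_derivative[OF q0]]) (use s in auto)
    \<comment> \<open>Strictness loses nothing: at s = s0 + \<tau> the dwell-time bound
      \<open>held_error\<close> still applies.\<close>
    have "(norm (P (x0 - X s)))\<^sup>2 \<le> \<kappa> * (norm (P (X s)))\<^sup>2" if "s0 + \<tau> < s"
      using next_communication_trigger[OF contX _ that, of \<kappa>] tau_pos s t order_trans[of "ereal s" "ereal t"]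
      by (simp add: held_initial disagreement_act)
    with held_error[of s] s
    have "lyapunov_rate x0 (X s) (V s) \<le> - \<rho> / 2 * ((norm (X s - xs))\<^sup>2 + (norm (q (V s)))\<^sup>2)"
      by (intro lyapunov_rate_decay) (auto simp: not_le[symmetric])
    also have "\<dots> \<le> - \<rho> / 2 * (W (X s) (V s) / lamE)"
    proof -
      have "W (X s) (V s) / lamE \<le> (norm (X s - xs))\<^sup>2 + (norm (q (V s)))\<^sup>2"
        using lyapunov_upper[OF q_zero_sum[OF q0], of s \<alpha> \<beta> \<phi> "X s - xs"] s lamE_pos
        by (simp add: lamE[symmetric] pos_divide_le_eq mult.commute)
      then show ?thesis using rho_bounds(1) by (intro mult_left_mono_neg) auto
    qed
    finally show "lyapunov_rate x0 (X s) (V s) \<le> - (\<rho> / (2 * lamE)) * W (X s) (V s)" by simp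
  qed
  then show ?thesis by (simp add: held_initial)
qed

lemma next_communication_held: "ereal (s0 + \<tau>) \<le> next_communication \<tau> \<kappa> s0 X"
proof (rule next_communication_ge)
  show "continuous_on {s0..} X"
    using held_X by (meson atLeast_iff continuous_on_eq_continuous_within has_vector_derivative_continuous)
qed (use tau_pos in simp)

end

section \<open>Gluing the intervals\<close>

lemma exponential_convergence:
  assumes sol: "event_triggered_solution A \<alpha> \<beta> g \<tau> \<kappa> T x v"
    and v0: "(\<Sum>i\<in>UNIV. v 0 $ i) = 0"
  shows "\<exists>C\<ge>0. \<forall>t\<ge>0. norm (x t $ i - xstar) \<le> C * exp (- (\<rho> / (4 * lamE)) * t)"
proof -
  let ?r = "\<rho> / (2 * lamE)"
  have T0: "T 0 = 0" and inf: "\<And>k. T k = \<infinity> \<Longrightarrow> T (Suc k) = \<infinity>"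
    using sol by (auto simp: event_triggered_solution_def)
  have step: "\<exists>X V. held_trajectory A \<alpha> \<beta> g s0 (x s0) (v s0) X V \<and> T (Suc k) = next_communication \<tau> \<kappa> s0 X \<and>
      (\<forall>s. s0 \<le> s \<and> ereal s \<le> T (Suc k) \<longrightarrow> x s = X s \<and> v s = V s)" if "T k = ereal s0" for k s0
    using sol that unfolding event_triggered_solution_def by blast
  have T_ge: "ereal (real k * \<tau>) \<le> T k" for k
  proof (induction k)
    case (Suc k)
    show ?case
    proof (cases "T k")
      case (real s0)
      obtain X V where "held_trajectory A \<alpha> \<beta> g s0 (x s0) (v s0) X V" "T (Suc k) = next_communication \<tau> \<kappa> s0 X"
        using step[OF real] by blast
      then have "ereal (s0 + \<tau>) \<le> T (Suc k)" using next_communication_held by simp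
      moreover have "real (Suc k) * \<tau> \<le> s0 + \<tau>" using Suc real by (simp add: algebra_simps)
      ultimately show ?thesis using order_trans ereal_less_eq(3) by blast
    qed (use Suc inf in auto)
  qed (simp add: T0)
  \<comment> \<open>The right end point is included, so the estimate at T (Suc k) serves as the
    initial value of the next interval.\<close>
  have interval: "P (q (v t)) = q (v t) \<and> W (x t) (v t) \<le> W (x s0) (v s0) * exp (- ?r * (t - s0))"
    if k: "T k = ereal s0" and q0: "P (q (v s0)) = q (v s0)" and t: "s0 \<le> t" "ereal t \<le> T (Suc k)" for k s0 t
  proof -
    obtain X V where XV: "held_trajectory A \<alpha> \<beta> g s0 (x s0) (v s0) X V" "T (Suc k) = next_communication \<tau> \<kappa> s0 X"
      "\<And>s. s0 \<le> s \<Longrightarrow> ereal s \<le> T (Suc k) \<Longrightarrow> x s = X s \<and> v s = V s"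
      using step[OF k] by blast
    show ?thesis
      using q_zero_sum[OF XV(1) q0 t(1)] held_decay[OF XV(1) q0 t(1)] t XV(2) XV(3)[OF t] by simp
  qed
  have q0: "P (q (v 0)) = q (v 0)"
    by (rule Pi_eq) (simp add: q_def gs_def sum.distrib v0 xstar scaleR_sum_right[symmetric])
  have inv: "P (q (v s0)) = q (v s0) \<and> W (x s0) (v s0) \<le> W (x 0) (v 0) * exp (- ?r * s0)"
    if "T k = ereal s0" for k s0
    using that
  proof (induction k arbitrary: s0)
    case (Suc k)
    then obtain s1 where s1: "T k = ereal s1"
      using inf[of k] T_ge[of k] by (cases "T k") auto
    note IH = Suc.IH[OF s1]
    obtain X V where "held_trajectory A \<alpha> \<beta> g s1 (x s1) (v s1) X V" "T (Suc k) = next_communication \<tau> \<kappa> s1 X"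
      using step[OF s1] by blast
    then have "ereal (s1 + \<tau>) \<le> ereal s0" using next_communication_held Suc.prems by metis
    then have "s1 \<le> s0" using tau_pos by simp
    with interval[OF s1 conjunct1[OF IH], of s0] Suc.prems
    have 1: "P (q (v s0)) = q (v s0)" "W (x s0) (v s0) \<le> W (x s1) (v s1) * exp (- ?r * (s0 - s1))" by auto
    note 1(2)
    also have "W (x s1) (v s1) * exp (- ?r * (s0 - s1)) \<le> W (x 0) (v 0) * exp (- ?r * s1) * exp (- ?r * (s0 - s1))"
      using IH by (intro mult_right_mono) auto
    also have "\<dots> = W (x 0) (v 0) * exp (- ?r * s0)"
      by (simp add: mult.assoc exp_add[symmetric] right_diff_distrib del: mult_minus_left)
    finally show ?case using 1(1) by blast
  qed (use T0 q0 in \<open>simp add: zero_ereal_def\<close>)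
  have decay: "W (x t) (v t) \<le> W (x 0) (v 0) * exp (- ?r * t)" if t: "t \<ge> 0" for t
  proof -
    \<comment> \<open>Every time lies in some interval, since T k \<ge> k \<tau> rules out
      accumulation; the last interval may be unbounded.\<close>
    have "\<exists>k. T k \<le> ereal t \<and> ereal t < T (Suc k)"
    proof (rule ccontr)
      assume neg: "\<not> ?thesis"
      have "T k \<le> ereal t" for k
      proof (induction k)
        case (Suc k)
        then show ?case using neg not_less by blast
      qed (use t T0 in simp)
      then have "ereal (real k * \<tau>) \<le> ereal t" for k using T_ge order_trans by blast
      then have "real k * \<tau> \<le> t" for k by simp
      moreover obtain k where "t < real k * \<tau>" using reals_Archimedean3[OF tau_pos] by blast
      ultimately show False using not_less by blast
    qed
    then obtain k where k: "T k \<le> ereal t" "ereal t < T (Suc k)" by blast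
    then obtain s0 where s0: "T k = ereal s0" using T_ge[of k] by (cases "T k") auto
    note IH = inv[OF s0]
    have "W (x t) (v t) \<le> W (x s0) (v s0) * exp (- ?r * (t - s0))"
      using interval[OF s0 conjunct1[OF IH], of t] k s0 by auto
    also have "\<dots> \<le> W (x 0) (v 0) * exp (- ?r * s0) * exp (- ?r * (t - s0))"
      using IH by (intro mult_right_mono) auto
    also have "\<dots> = W (x 0) (v 0) * exp (- ?r * t)"
      by (simp add: mult.assoc exp_add[symmetric] right_diff_distrib del: mult_minus_left)
    finally show ?thesis .
  qed
  have lower: "\<alpha> * \<phi> / 2 * (norm (x t - xs))\<^sup>2 \<le> W (x t) (v t)" for t
    by (rule lyapunov_lower[OF params(1,2) phi_pos])
  define C where "C = sqrt (2 * W (x 0) (v 0) / (\<alpha> * \<phi>))"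
  have \<alpha>\<phi>: "\<alpha> * \<phi> > 0" using params phi_pos by simp
  have W0: "W (x 0) (v 0) \<ge> 0" using order_trans[OF _ lower[of 0]] \<alpha>\<phi> by simp
  show ?thesis
  proof (intro exI[of _ C] conjI allI impI)
    show "C \<ge> 0" unfolding C_def using W0 \<alpha>\<phi> by simp
    fix t :: real assume t: "t \<ge> 0"
    have "\<alpha> * \<phi> / 2 * (norm (x t - xs))\<^sup>2 \<le> W (x 0) (v 0) * exp (- ?r * t)"
      using lower decay[OF t] by (rule order_trans)
    then have "(norm (x t - xs))\<^sup>2 \<le> 2 * W (x 0) (v 0) / (\<alpha> * \<phi>) * exp (- ?r * t)"
      using \<alpha>\<phi> by (simp add: field_simps)
    \<comment> \<open>W controls the squared deviation, so the square root turns \<rho> / (2 lamE)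
      into \<rho> / (4 lamE).\<close>
    also have "exp (- ?r * t) = (exp (- (\<rho> / (4 * lamE)) * t))\<^sup>2"
      by (simp add: exp_double[symmetric])
    also have "2 * W (x 0) (v 0) / (\<alpha> * \<phi>) = C\<^sup>2" unfolding C_def using W0 \<alpha>\<phi> by simp
    finally have "(norm (x t - xs))\<^sup>2 \<le> (C * exp (- (\<rho> / (4 * lamE)) * t))\<^sup>2" by (simp add: power_mult_distrib)
    then have "norm (x t - xs) \<le> C * exp (- (\<rho> / (4 * lamE)) * t)"
      by (rule power2_le_imp_le) (use \<open>C \<ge> 0\<close> in simp)
    moreover have "norm (x t $ i - xstar) \<le> norm (x t - xs)"
      using Finite_Cartesian_Product.norm_nth_le[of "x t - xs" i] by (simp add: xs_def)
    ultimately show "norm (x t $ i - xstar) \<le> C * exp (- (\<rho> / (4 * lamE)) * t)" by linarith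
  qed
qed

end

section \<open>Exponential convergence\<close>

lemma sum_gradient_minimizer:
  assumes "\<And>i y. GDERIV (f i) y :> g i y"
    and min: "is_arg_min (\<lambda>y. \<Sum>i\<in>I. f i y) (\<lambda>_. True) x"
  shows "(\<Sum>i\<in>I. g i x) = 0"
proof -
  let ?F = "\<lambda>y. \<Sum>i\<in>I. f i y"
  have "(?F has_derivative (\<lambda>h. \<Sum>i\<in>I. h \<bullet> g i x)) (at x)"
    using assms(1) unfolding gderiv_def by (intro has_derivative_sum)
  moreover have "?F x \<le> ?F y" for y
    using min by (simp add: is_arg_min_linorder)
  ultimately have "(\<lambda>h. \<Sum>i\<in>I. h \<bullet> g i x) = (\<lambda>h. 0)"
    by (intro has_derivative_local_min) auto
  from fun_cong[OF this, of "\<Sum>i\<in>I. g i x"] show ?thesis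
    by (simp add: inner_sum_right[symmetric])
qed

text \<open>A single unit test vector compares the constants; the resulting mmin \<le> Mmax enters
  \<kappa> < 1.\<close>

lemma strong_convexity_le_lipschitz:
  fixes g :: "real^'d \<Rightarrow> real^'d"
  assumes "strongly_convex_grad m g" and "M-lipschitz_on UNIV g"
  shows "m \<le> M"
proof -
  let ?z = "axis undefined 1 :: real^'d"
  have "m * (norm ?z)\<^sup>2 \<le> ?z \<bullet> (g ?z - g 0)"
    using assms(1) unfolding strongly_convex_grad_def by (metis diff_zero)
  also have "\<dots> \<le> norm ?z * norm (g ?z - g 0)" by (rule norm_cauchy_schwarz)
  also have "\<dots> \<le> norm ?z * (M * norm ?z)"
    using lipschitz_on_normD[OF assms(2), of ?z 0] by (intro mult_left_mono) auto
  finally show ?thesis by simp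
qed

theorem theorem12:
  fixes A :: "real^'n^'n" and R :: "real^'m^'n"
    and f :: "'n \<Rightarrow> real^'d \<Rightarrow> real" and g :: "'n \<Rightarrow> real^'d \<Rightarrow> real^'d"
    and m M :: "'n \<Rightarrow> real" and xstar :: "real^'d"
    and lam :: "nat \<Rightarrow> real"
    and \<alpha> \<beta> \<epsilon> \<delta> mmin Mmax lam2 lamN \<phi> \<zeta> \<tau> \<kappa> lamE rate :: real
    and T :: "nat \<Rightarrow> ereal" and x v :: "real \<Rightarrow> (real^'d)^'n"
  assumes N: "CARD('n) \<ge> 2"
    and graph: "connected_weighted_graph A"
    and lam: "ordered_eigenvalues (laplacian A) lam"
    and lam2: "lam2 = lam 2"
    and lamN: "lamN = lam CARD('n)"
    and grad: "\<And>i y. GDERIV (f i) y :> g i y"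
    and m_pos: "\<And>i. m i > 0"
    and M_pos: "\<And>i. M i > 0"
    and strongly_convex: "\<And>i. strongly_convex_grad (m i) (g i)"
    and lipschitz: "\<And>i. (M i)-lipschitz_on UNIV (g i)"
    and mmin: "mmin = Min (range m)"
    and Mmax: "Mmax = Max (range M)"
    and xstar: "is_arg_min (\<lambda>y. \<Sum>i\<in>UNIV. f i y) (\<lambda>_. True) xstar"
    and params: "\<alpha> > 0" "\<beta> > 0" "0 < \<epsilon>" "\<epsilon> < 1" "\<delta> > 0"
    and phi: "\<phi> = 1 / (2 * mmin) * Mmax\<^sup>2 + 1 / (2 * mmin * \<alpha>\<^sup>2) * \<delta> - 1"
    and phi_pos: "\<phi> > 0"
    and zeta_pos: "\<zeta> > 0"
    and zeta: "\<zeta>\<^sup>2 = 2 * \<epsilon> * (1 - \<epsilon>) * lam2 * min \<delta> 1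
                 / (\<alpha> * \<beta> * lamN\<^sup>2 * \<phi> + 4 * \<alpha>\<^sup>2 * lam2 * (1 + \<phi>)\<^sup>2)"
    and tau: "\<tau> = 1 / (\<alpha> * Mmax + 1)
                 * ln (1 + (\<alpha> * Mmax + 1) * \<zeta>
                         / (\<alpha> * Mmax + 1 + \<beta> * lamN * sqrt (1 + \<alpha>\<^sup>2) * (1 + \<zeta>)))"
    and kappa: "\<kappa> = 2 * ((\<epsilon> * \<delta> * lam2 + 2 * \<phi> * \<alpha> * \<beta> * lam2\<^sup>2 * \<epsilon>\<^sup>2 * (1 - \<epsilon>))
                 / (\<alpha> * \<beta> * \<phi> * lamN\<^sup>2 + 2 * lam2 * \<alpha>\<^sup>2 * (1 + \<phi>)\<^sup>2))"
    and R_dim: "CARD('m) = CARD('n) - 1"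
    and R: "1 v* R = 0" "transpose R ** R = mat 1" "R ** transpose R = centering"
    and lamE: "lamE = Max {c. eigenvalue
                 (E_matrix \<alpha> \<beta> \<phi> (laplacian A) R
                    :: real^('d + ('m \<times> 'd + 'm \<times> 'd))^('d + ('m \<times> 'd + 'm \<times> 'd))) c}"
    and rate: "rate = (1/4) * Min {\<delta>, 2 * \<phi> * \<alpha> * \<beta> * lam2 * (1 - \<epsilon>)\<^sup>2, 1 - \<epsilon>, (1/2) * \<epsilon>} / lamE"
    and solution: "event_triggered_solution A \<alpha> \<beta> g \<tau> \<kappa> T x v"
    and v_init: "(\<Sum>i\<in>UNIV. v 0 $ i) = 0"
  shows "\<kappa> < 1 \<and> rate > 0 \<and>
         (\<forall>i. \<exists>C\<ge>0. \<forall>t\<ge>0. norm (x t $ i - xstar) \<le> C * exp (- rate * t))"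
proof -
  have lam2_pos: "lam 2 > 0"
  proof -
    \<comment> \<open>The formula for \<open>\<zeta>\<^sup>2\<close> has \<open>lam 2\<close> as a
      factor of its numerator, so \<open>lam 2 = 0\<close> would give \<zeta> = 0.\<close>
    have "lam 2 \<noteq> 0" using zeta zeta_pos unfolding lam2 by auto
    then show ?thesis using second_eigenvalue_nonneg[OF N graph lam] by simp
  qed
  have mmin_le: "mmin \<le> m i" and Mmax_ge: "M i \<le> Mmax" for i
    unfolding mmin Mmax by simp_all
  have mmin_pos: "mmin > 0" unfolding mmin using m_pos by simp
  have mono: "mmin * (norm (z - x))\<^sup>2 \<le> (z - x) \<bullet> (g i z - g i x)" for i x z
  proof -
    have "mmin * (norm (z - x))\<^sup>2 \<le> m i * (norm (z - x))\<^sup>2"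
      by (intro mult_right_mono mmin_le) simp
    also have "\<dots> \<le> (z - x) \<bullet> (g i z - g i x)"
      using strongly_convex unfolding strongly_convex_grad_def by blast
    finally show ?thesis .
  qed
  have lip: "norm (g i z - g i x) \<le> Mmax * norm (z - x)" for i x z
  proof -
    have "norm (g i z - g i x) \<le> M i * norm (z - x)"
      by (rule lipschitz_on_normD[OF lipschitz]) auto
    also have "\<dots> \<le> Mmax * norm (z - x)" by (intro mult_right_mono Mmax_ge) simp
    finally show ?thesis .
  qed
  have "mmin \<le> Mmax"
    using mmin_le Mmax_ge strong_convexity_le_lipschitz[OF strongly_convex lipschitz] order_trans by metis
  interpret event_triggered_network A R lam g xstar mmin Mmax \<alpha> \<beta> \<epsilon> \<delta> \<phi> \<zeta> \<tau> \<kappa> lamE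
    by unfold_locales
      (fact N graph lam lam2_pos R mono lip sum_gradient_minimizer[OF grad xstar] mmin_pos \<open>mmin \<le> Mmax\<close>
        params phi phi_pos zeta_pos zeta[unfolded lam2 lamN] tau[unfolded lamN] kappa[unfolded lam2 lamN] lamE)+
  have rate: "rate = \<rho> / (4 * lamE)"
    unfolding rate \<rho>_def lam2 by simp
  then have "rate > 0" using rho_bounds(1) lamE_pos by simp
  with kappa_lt_1 exponential_convergence[OF solution v_init] show ?thesis
    unfolding rate by blast
qed

end
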